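(* Let $n\ge 1$, let $p\ge 2$, and let $f\in\mathcal{C}^{2}(\mathbb{B}^{n})$ be a complex-valued function satisfying $\mathrm{Re}\big(f(z)\overline{\Delta f(z)}\big)\ge 0$ for all $z\in\mathbb{B}^n$. Then $$\int_{\mathbb{B}^{n}}d(z)\,\Delta\big(|f(z)|^{p}\big)\,dV_{N}(z)<\infty$$ if and only if $f\in \mathcal{H}_{g}^{p}(\mathbb{B}^{n})$.
   Context: $\mathbb{B}^n=\{z\in\mathbb{C}^n:\|z\|<1\}$ is the open unit ball of $\mathbb{C}^n$ with the Euclidean norm $\|z\|=(\sum_k|z_k|^2)^{1/2}$ (also written $|z|$), and $d(z)=1-|z|$ is the distance from $z$ to $\partial\mathbb{B}^n$. $dV_N$ is the normalized Lebesgue volume measure on $\mathbb{B}^n$ and $d\sigma$ the normalized surface measure on $\partial\mathbb{B}^n$. $\mathcal{C}^m(\mathbb{B}^n)$ is the set of $m$ times continuously differentiable complex-valued functions on $\mathbb{B}^n$. $\Delta=4\sum_{k=1}^n\frac{\partial^2}{\partial z_k\partial\overline{z}_k}=\sum_{k=1}^n\big(\frac{\partial^2}{\partial x_k^2}+\frac{\partial^2}{\partial y_k^2}\big)$, $z_k=x_k+iy_k$. For $r\in(0,1)$, $M_p(r,f)=\big(\int_{\partial\mathbb{B}^n}|f(r\zeta)|^p\,d\sigma(\zeta)\big)^{1/p}$. For $p\in(0,\infty)$ the generalized Hardy space $\mathcal{H}_g^p(\mathbb{B}^n)$ consists of measurable $f:\mathbb{B}^n\to\mathbb{C}$ such that $M_p(r,f)$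 exists for all $r\in(0,1)$ and $\sup_{0<r<1}M_p(r,f)<\infty$. *)

theory Defs
  imports "HOL-Analysis.Analysis"
begin

text \<open>Complex n-space is modelled as complex ^ 'n for a finite index type 'n
  (n = CARD('n) \<ge> 1).  It is a real euclidean space of real dimension 2n whose
  real basis consists of the vectors axis k 1 and axis k i, i.e. the directions
  of x_k and y_k.\<close>

definition dist_bd :: "complex ^ 'n \<Rightarrow> real" where
  "dist_bd z = 1 - norm z"

definition C2_on :: "'a::euclidean_space set \<Rightarrow> ('a \<Rightarrow> 'b::real_normed_vector) \<Rightarrow> bool" where
  "C2_on S f \<longleftrightarrow> (\<exists>f' :: 'a \<Rightarrow> ('a \<Rightarrow>\<^sub>L 'b). \<exists>f'' :: 'a \<Rightarrow> ('a \<Rightarrow>\<^sub>L ('a \<Rightarrow>\<^sub>L 'b)).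
      (\<forall>z\<in>S. (f has_derivative blinfun_apply (f' z)) (at z)) \<and>
      (\<forall>z\<in>S. (f' has_derivative blinfun_apply (f'' z)) (at z)) \<and>
      continuous_on S f'')"

definition laplacian :: "('a::euclidean_space \<Rightarrow> 'b::real_normed_vector) \<Rightarrow> 'a \<Rightarrow> 'b" where
  "laplacian g z = (\<Sum>b\<in>Basis.
      vector_derivative (\<lambda>s. vector_derivative (\<lambda>t. g (z + t *\<^sub>R b)) (at s)) (at 0))"

definition dVN :: "(complex ^ 'n) measure" where
  "dVN = density (restrict_space lborel (ball 0 1))
           (\<lambda>_. 1 / emeasure lborel (ball (0::complex ^ 'n) 1))"

text \<open>Normalized surface measure on the unit sphere, obtained as the image of
  the normalized volume measure under the radial projection z \<mapsto> z/|z|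
  (this is the unique rotation invariant probability measure on the sphere).\<close>
definition sigmaS :: "(complex ^ 'n) measure" where
  "sigmaS = distr (restrict_space dVN (ball 0 1 - {0}))
                  (restrict_space borel (sphere (0::complex ^ 'n) 1)) sgn"

definition Mp :: "real \<Rightarrow> real \<Rightarrow> (complex ^ 'n \<Rightarrow> complex) \<Rightarrow> real" where
  "Mp p r f = (\<integral>\<zeta>. norm (f (r *\<^sub>R \<zeta>)) powr p \<partial>sigmaS) powr (1 / p)"

definition hardy_g :: "real \<Rightarrow> (complex ^ 'n \<Rightarrow> complex) set" where
  "hardy_g p = {f. f \<in> borel_measurable (restrict_space lebesgue (ball 0 1)) \<and>
      (\<forall>r\<in>{0<..<1}. integrable sigmaS (\<lambda>\<zeta>. norm (f (r *\<^sub>R \<zeta>)) powr p)) \<and>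
      bdd_above ((\<lambda>r. Mp p r f) ` {0<..<1})}"

end

(* With u = |f|^p, which is C^2 because p >= 2, the sign condition on f gives laplacian u >= 0.
   Let m(r) be the mean of u over the sphere of radius r and N the real dimension. Integrating by
   parts against s^2 - |z|^2, which vanishes on the sphere of radius s, gives
     A(s) := integral over |z| < s of (s^2 - |z|^2) (laplacian u)(z) = 2 * integral over |z| < s of Du(z) z,
   and differentiating in s gives A'(s) = const * s^N * m'(s). Since A is nondecreasing, m' >= 0, and
   A and m are bounded or unbounded together as s tends to 1. Finally A(s) increases to the integral
   of (1 - |z|^2) (laplacian u)(z), and 1 - |z| <= 1 - |z|^2 <= 2 (1 - |z|). *)

theory Submission
  imports Defs
begin

text \<open>Spheres are handled through the ball: a mean over the sphere of radius r becomes an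
  integral over the unit ball of \<open>u (r *\<^sub>R sgn z)\<close>, whose integrand is constant
  along rays, and integration by parts reduces to the vanishing integral of a directional
  derivative. The surface measure enters only in the final translation. The weight s^2 - |z|^2 is a
  polynomial, so it has no singularity at the origin, and its gradient -2z produces exactly Du(z) z,
  the quantity that also governs the derivative of the means. The delicate points are the zeros of
  f, where |w|^p must be differentiated twice at w = 0; p \<ge> 2 is what keeps the second
  derivatives continuous there. The sign condition is used as a real inner product: Re (f cnj (Delta
  f)) is the product of f and Delta f as vectors of the plane, and the Laplacian of |f|^p differs
  from p |f|^(p-2) times it by a sum of squares with nonnegative coefficients.\<close>

section \<open>Integrals over balls\<close>

text \<open>\<open>F\<close> extends to a compactly supported Lipschitz function \<open>G\<close>; by translation invariance
  the difference quotients of \<open>G\<close> in direction \<open>b\<close> have integral zero, and they converge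
  dominatedly to \<open>F' z b\<close> inside the ball and to zero outside.\<close>

lemma set_integral_ball_derivative_eq_0:
  fixes F :: "'a::euclidean_space \<Rightarrow> real"
  assumes s: "0 < s"
    and der: "\<And>z. norm z \<le> s \<Longrightarrow> (F has_derivative F' z) (at z)"
    and bound: "\<And>z h. norm z \<le> s \<Longrightarrow> \<bar>F' z h\<bar> \<le> L * norm h"
    and cont: "continuous_on (cball 0 s) (\<lambda>z. F' z b)"
    and bdry: "\<And>z. norm z = s \<Longrightarrow> F z = 0"
  shows "(LINT z:ball 0 s|lborel. F' z b) = 0"
proof -
  \<comment> \<open>Composing with the nearest-point projection keeps the Lipschitz constant,
    because the projection is 1-Lipschitz. Points outside the ball go to the sphere, where
    \<open>F\<close> vanishes, so \<open>G\<close> is the extension of \<open>F\<close> by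
    zero.\<close>
  define P where "P = closest_point (cball (0::'a) s)"
  define G where "G = F \<circ> P"
  define t where "t = (\<lambda>n::nat. inverse (real (Suc n)))"
  have L: "0 \<le> L"
  proof -
    obtain e :: 'a where "norm e = 1" using vector_choose_size[of 1] by auto
    then show ?thesis using bound[of 0 e] s by auto
  qed
  have Pin: "P z \<in> cball 0 s" for z
    unfolding P_def by (rule closest_point_in_set) (use s in auto)
  have Pself: "P z = z" if "norm z \<le> s" for z
    unfolding P_def using that by (intro closest_point_self) auto
  have Pout: "norm (P z) = s" if "s \<le> norm z" for z
  proof -
    have "closest_point (cball (0::'a) s) z \<in> rel_frontier (cball 0 s)"
      using s that
      by (intro closest_point_in_rel_frontier)
         (auto simp: affine_hull_nonempty_interior rel_interior_nonempty_interior)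
    then show ?thesis using s unfolding P_def by simp
  qed
  have Flip: "\<bar>F x - F y\<bar> \<le> L * norm (x - y)" if "x \<in> cball 0 s" "y \<in> cball 0 s" for x y
  proof -
    have "norm (F x - F y) \<le> L * norm (x - y)"
    proof (rule differentiable_bound[of "cball 0 s" F F'])
      show "onorm (F' z) \<le> L" if "z \<in> cball 0 s" for z
        using bound[of z] that L by (intro onorm_le) auto
    qed (use that in \<open>auto intro!: has_derivative_at_withinI der\<close>)
    then show ?thesis by simp
  qed
  have Glip: "\<bar>G x - G y\<bar> \<le> L * norm (x - y)" for x y
  proof -
    have "\<bar>G x - G y\<bar> \<le> L * norm (P x - P y)"
      unfolding G_def comp_def by (intro Flip Pin)
    also have "\<dots> \<le> L * norm (x - y)"
      using closest_point_lipschitz[of "cball (0::'a) s" x y] s L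
      by (intro mult_left_mono) (auto simp: P_def dist_norm)
    finally show ?thesis .
  qed
  have G0: "G z = 0" if "s \<le> norm z" for z
    using Pout[OF that] bdry by (simp add: G_def)
  have Gcont: "continuous_on UNIV G"
    by (rule lipschitz_on_continuous_on[of L], rule lipschitz_onI)
       (use Glip L in \<open>auto simp: dist_norm\<close>)
  have Gmeas [measurable]: "G \<in> borel_measurable borel"
    by (rule borel_measurable_continuous_onI[OF Gcont])
  have Gint: "integrable lborel G"
  proof -
    have "integrable lborel (\<lambda>x. indicator (cball 0 s) x *\<^sub>R G x)"
      by (rule borel_integrable_compact) (use Gcont continuous_on_subset in auto)
    also have "(\<lambda>x. indicator (cball 0 s) x *\<^sub>R G x) = G"
      using G0 by (auto simp: fun_eq_iff indicator_def)
    finally show ?thesis .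
  qed
  have shift: "integrable lborel (\<lambda>z. G (c + z))" "(LINT z|lborel. G (c + z)) = (LINT z|lborel. G z)" for c
    using Gint integrable_distr_eq[of "(+) c" lborel borel G] integral_distr[of "(+) c" lborel borel G]
    by (simp_all add: lborel_distr_plus)
  define D where "D n z = (G (t n *\<^sub>R b + z) - G z) / t n" for n z
  have t: "0 < t n" "t n \<le> 1" for n
    by (auto simp: t_def divide_simps)
  have t0: "t \<longlonglongrightarrow> 0"
    unfolding t_def by (rule LIMSEQ_inverse_real_of_nat)
  have "(\<lambda>n. integral\<^sup>L lborel (D n)) \<longlonglongrightarrow> (LINT z|lborel. indicator (ball 0 s) z *\<^sub>R F' z b)"
  proof (rule integral_dominated_convergence)
    show "(\<lambda>z. indicator (ball 0 s) z *\<^sub>R F' z b) \<in> borel_measurable lborel"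
      using borel_measurable_continuous_on_indicator[of "ball 0 s" "\<lambda>z. F' z b"]
        continuous_on_subset[OF cont, of "ball 0 s"] by simp
    show "D n \<in> borel_measurable lborel" for n
      unfolding D_def[abs_def] by measurable
    \<comment> \<open>Since \<open>t n\<close> is at most 1, a point beyond radius
      \<open>s + norm b\<close> stays outside the ball after the shift by
      \<open>t n *\<^sub>R b\<close>, so the quotient is 0 there.\<close>
    show "integrable lborel (\<lambda>z. indicator (cball 0 (s + norm b)) z *\<^sub>R (L * norm b))"
      by (rule borel_integrable_compact) auto
    show "AE z in lborel. norm (D n z) \<le> indicator (cball 0 (s + norm b)) z *\<^sub>R (L * norm b)" for n
    proof (rule AE_I2)
      fix z :: 'a
      show "norm (D n z) \<le> indicator (cball 0 (s + norm b)) z *\<^sub>R (L * norm b)"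
      proof (cases "z \<in> cball 0 (s + norm b)")
        case True
        have "\<bar>G (t n *\<^sub>R b + z) - G z\<bar> \<le> L * (t n * norm b)"
          using Glip[of "t n *\<^sub>R b + z" z] t[of n] by simp
        then show ?thesis using True t[of n] by (simp add: D_def field_simps)
      next
        case False
        have "norm (t n *\<^sub>R b) \<le> norm b"
          using t[of n] mult_right_mono[of "t n" 1 "norm b"] by simp
        then have "s \<le> norm (t n *\<^sub>R b + z)"
          using False norm_triangle_ineq4[of "t n *\<^sub>R b + z" "t n *\<^sub>R b"] by simp
        then have "G (t n *\<^sub>R b + z) = 0" "G z = 0"
          using False norm_ge_zero[of b] by (simp_all add: G0 not_le del: norm_ge_zero)
        then show ?thesis using L by (simp add: D_def)
      qed
    qed
    \<comment> \<open>Only on the sphere itself can \<open>G\<close> fail to be differentiable; it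
      is a null set.\<close>
    have "sphere (0::'a) s \<in> null_sets lborel"
      using negligible_sphere[of "0::'a" s]
      by (auto simp: null_sets_completion_iff negligible_iff_null_sets)
    then have "AE z in lborel. z \<notin> sphere (0::'a) s"
      by (rule AE_not_in)
    then show "AE z in lborel. (\<lambda>n. D n z) \<longlonglongrightarrow> indicator (ball 0 s) z *\<^sub>R F' z b"
    proof (rule AE_mp, intro AE_I2 impI)
      fix z :: 'a assume z: "z \<notin> sphere 0 s"
      have "(G has_derivative (if z \<in> ball 0 s then F' z else (\<lambda>_. 0))) (at z)"
      proof (cases "z \<in> ball 0 s")
        case True
        have "(G has_derivative F' z) (at z)"
          by (rule has_derivative_transform_within_open[of F _ _ _ "ball 0 s"])
             (use True der in \<open>auto simp: G_def Pself\<close>)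
        then show ?thesis using True by simp
      next
        case False
        have "(G has_derivative (\<lambda>_. 0)) (at z)"
          by (rule has_derivative_transform_within_open[of "\<lambda>_. 0" _ _ _ "- cball 0 s"])
             (use False z G0 in auto)
        then show ?thesis using False by simp
      qed
      moreover have "((\<lambda>h. h *\<^sub>R b + z) has_derivative (\<lambda>h. h *\<^sub>R b)) (at 0)"
        by (rule derivative_eq_intros refl | simp)+
      ultimately have "((\<lambda>h. G (h *\<^sub>R b + z)) has_derivative
          (\<lambda>h. (if z \<in> ball 0 s then F' z else (\<lambda>_. 0)) (h *\<^sub>R b))) (at 0)"
        using has_derivative_compose[of "\<lambda>h. h *\<^sub>R b + z" "\<lambda>h. h *\<^sub>R b" 0 UNIV G] by simp
      moreover have "(\<lambda>h. (if z \<in> ball 0 s then F' z else (\<lambda>_. 0)) (h *\<^sub>R b))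
          = (*) (indicator (ball 0 s) z *\<^sub>R F' z b)"
        using linear_cmul[OF has_derivative_linear[OF der[of z]], of _ b]
        by (auto simp: fun_eq_iff)
      ultimately have "((\<lambda>h. G (h *\<^sub>R b + z)) has_real_derivative indicator (ball 0 s) z *\<^sub>R F' z b) (at 0)"
        by (simp add: has_field_derivative_def)
      then have "((\<lambda>h. (G (h *\<^sub>R b + z) - G z) / h) \<longlongrightarrow> indicator (ball 0 s) z *\<^sub>R F' z b) (at 0)"
        by (simp add: DERIV_def)
      moreover have "filterlim t (at 0) sequentially"
        using t0 t(1) by (auto simp: filterlim_at less_imp_neq intro!: eventuallyI)
          (metis less_irrefl)
      ultimately show "(\<lambda>n. D n z) \<longlonglongrightarrow> indicator (ball 0 s) z *\<^sub>R F' z b"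
        unfolding D_def by (rule filterlim_compose)
    qed
  qed
  moreover have "integral\<^sup>L lborel (D n) = 0" for n
    using shift Gint unfolding D_def by simp
  ultimately show ?thesis
    unfolding set_lebesgue_integral_def by (simp add: LIMSEQ_const_iff)
qed

text \<open>The sum of the absolute values on the basis dominates the norm of the functional and is
  a continuous real function on the compact set. This supplies the uniform bound needed for
  integration by parts from continuity of the components alone.\<close>

lemma linear_functionals_bounded_on_compact:
  fixes T :: "'b::topological_space \<Rightarrow> 'a::euclidean_space \<Rightarrow> real"
  assumes "compact K" "\<And>z. z \<in> K \<Longrightarrow> linear (T z)"
    and "\<And>b. b \<in> Basis \<Longrightarrow> continuous_on K (\<lambda>z. T z b)"
  obtains L where "\<And>z h. z \<in> K \<Longrightarrow> \<bar>T z h\<bar> \<le> L * norm h"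
proof -
  have "compact ((\<lambda>z. \<Sum>b\<in>Basis. \<bar>T z b\<bar>) ` K)"
    using assms by (intro compact_continuous_image continuous_intros) auto
  then have "bounded ((\<lambda>z. \<Sum>b\<in>Basis. \<bar>T z b\<bar>) ` K)"
    by (rule compact_imp_bounded)
  then obtain L where "\<forall>z\<in>K. \<bar>\<Sum>b\<in>Basis. \<bar>T z b\<bar>\<bar> \<le> L"
    unfolding bounded_iff by auto
  then have L: "(\<Sum>b\<in>Basis. \<bar>T z b\<bar>) \<le> L" if "z \<in> K" for z
    using that abs_ge_self order_trans by blast
  have "\<bar>T z h\<bar> \<le> L * norm h" if "z \<in> K" for z h
  proof -
    have "T z h = T z (\<Sum>b\<in>Basis. (h \<bullet> b) *\<^sub>R b)"
      by (simp add: euclidean_representation)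
    also have "\<dots> = (\<Sum>b\<in>Basis. (h \<bullet> b) * T z b)"
      using assms(2)[OF that] by (simp add: linear_sum linear_cmul)
    also have "\<bar>\<dots>\<bar> \<le> (\<Sum>b\<in>Basis. norm h * \<bar>T z b\<bar>)"
      by (rule order_trans[OF sum_abs])
         (auto intro!: sum_mono mult_right_mono simp: abs_mult Basis_le_norm)
    also have "\<dots> = (\<Sum>b\<in>Basis. \<bar>T z b\<bar>) * norm h"
      by (simp add: sum_distrib_left mult.commute)
    also have "\<dots> \<le> L * norm h"
      using L[OF that] by (intro mult_right_mono) auto
    finally show ?thesis .
  qed
  then show ?thesis by (rule that)
qed

lemma set_integrable_ball_continuous:
  fixes g :: "'a::euclidean_space \<Rightarrow> real"
  assumes "continuous_on (cball 0 s) g"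
  shows "set_integrable lborel (ball 0 s) g"
proof (rule set_integrable_subset)
  show "set_integrable lborel (cball 0 s) g"
    unfolding set_integrable_def by (rule borel_integrable_compact) (use assms in auto)
qed auto

section \<open>Functions of the direction \<open>sgn z\<close> and integrals over balls\<close>

lemma norm_scaleR_sgn_le: "norm (r *\<^sub>R sgn z) \<le> \<bar>r\<bar>"
  by (simp add: norm_sgn)

lemma scaleR_sgn_in_ball: "\<bar>r\<bar> < e \<Longrightarrow> r *\<^sub>R sgn z \<in> ball 0 e"
  for z :: "'a::euclidean_space"
  using order_le_less_trans[OF norm_scaleR_sgn_le[of r z]] by simp

text \<open>Nothing is known about \<open>g\<close> outside the unit ball. Inserting the indicator
  of the ball, which is 1 at every point \<open>r *\<^sub>R sgn z\<close>, yields a globally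
  measurable function without changing the values.\<close>

lemma borel_measurable_scaleR_sgn:
  fixes g :: "'a::euclidean_space \<Rightarrow> real"
  assumes g: "continuous_on (ball 0 1) g" and r: "\<bar>r\<bar> < 1"
  shows "(\<lambda>z. g (r *\<^sub>R sgn z)) \<in> borel_measurable borel"
proof -
  have "(\<lambda>z. indicator (ball 0 1) (r *\<^sub>R sgn z) *\<^sub>R g (r *\<^sub>R sgn z)) \<in> borel_measurable borel"
    by (rule measurable_compose[OF _ borel_measurable_continuous_on_indicator[OF _ g]]) auto
  then show ?thesis
    by (simp only: indicator_simps(1)[OF scaleR_sgn_in_ball[OF r]] scaleR_one)
qed

lemma bounded_on_smaller_cball:
  fixes g :: "'a::euclidean_space \<Rightarrow> real"
  assumes "continuous_on (ball 0 1) g" "r < 1"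
  obtains B where "\<And>z. norm z \<le> r \<Longrightarrow> \<bar>g z\<bar> \<le> B"
proof -
  have "compact (g ` cball 0 r)"
    using assms by (intro compact_continuous_image continuous_on_subset[OF assms(1)]) auto
  then have "bounded (g ` cball 0 r)"
    by (rule compact_imp_bounded)
  then obtain B where "\<forall>x\<in>cball 0 r. \<bar>g x\<bar> \<le> B"
    unfolding bounded_iff by auto
  then show ?thesis
    by (intro that[of B]) simp
qed

text \<open>The integrand jumps at the origin because \<open>sgn 0 = 0\<close>, so integrability
  comes from measurability and boundedness instead of continuity.\<close>

lemma set_integrable_ball_sgn:
  fixes g :: "'a::euclidean_space \<Rightarrow> real"
  assumes "continuous_on (ball 0 1) g" and r: "\<bar>r\<bar> < 1"
  shows "set_integrable lborel (ball 0 s) (\<lambda>z. g (r *\<^sub>R sgn z))"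
proof -
  obtain B where B: "\<And>z. norm z \<le> \<bar>r\<bar> \<Longrightarrow> \<bar>g z\<bar> \<le> B"
    using bounded_on_smaller_cball[OF assms] by metis
  show ?thesis
    unfolding set_integrable_def
  proof (rule integrableI_bounded_set_indicator)
    show "AE z in lborel. z \<in> ball 0 s \<longrightarrow> norm (g (r *\<^sub>R sgn z)) \<le> B"
      by (intro AE_I2 impI) (simp only: real_norm_def B norm_scaleR_sgn_le)
  qed (use borel_measurable_scaleR_sgn[OF assms] emeasure_lborel_ball_finite in auto)
qed

lemma set_integral_ball_scale:
  fixes k :: "'a::euclidean_space \<Rightarrow> real"
  assumes k [measurable]: "k \<in> borel_measurable borel" and r: "0 < r"
  shows "(LINT z:ball 0 r|lborel. k z) = r ^ DIM('a) * (LINT z:ball 0 1|lborel. k (r *\<^sub>R z))"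
proof -
  have "(LINT z|lborel. indicator (ball 0 r) z * k z) =
      (LINT z|density (distr lborel borel (\<lambda>x. 0 + r *\<^sub>R x)) (\<lambda>_. \<bar>r\<bar> ^ DIM('a)). indicator (ball 0 r) z * k z)"
    using r lborel_affine[of r "0::'a"] by simp
  also have "\<dots> = (LINT z|lborel. \<bar>r\<bar> ^ DIM('a) * (indicator (ball 0 r) (r *\<^sub>R z) * k (r *\<^sub>R z)))"
  proof -
    have "(\<lambda>z. indicator (ball 0 r) z * k z) \<in> borel_measurable borel"
      by (intro borel_measurable_times borel_measurable_indicator k) auto
    then show ?thesis using r by (subst integral_density) (simp_all add: integral_distr)
  qed
  also have "\<dots> = (LINT z|lborel. r ^ DIM('a) * (indicator (ball 0 1) z * k (r *\<^sub>R z)))"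
    using r by (intro Bochner_Integration.integral_cong) (auto simp: indicator_def)
  finally show ?thesis
    by (simp add: set_lebesgue_integral_def)
qed

text \<open>\<open>sgn\<close> is invariant under positive scaling, so the change of variables
  leaves only the volume factor. This does the work of polar coordinates.\<close>

lemma set_integral_ball_sgn_scale:
  fixes g :: "'a::euclidean_space \<Rightarrow> real"
  assumes "continuous_on (ball 0 1) g" "\<bar>s\<bar> < 1" "0 < r"
  shows "(LINT z:ball 0 r|lborel. g (s *\<^sub>R sgn z)) = r ^ DIM('a) * (LINT z:ball 0 1|lborel. g (s *\<^sub>R sgn z))"
  using set_integral_ball_scale[OF borel_measurable_scaleR_sgn[OF assms(1,2)] assms(3)] assms(3)
  by (simp add: sgn_scaleR)

lemma set_integral_const_ball:
  "(LINT z:ball (0::'a::euclidean_space) r|lborel. c) = measure lborel (ball (0::'a) r) * c"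
  using emeasure_lborel_ball_finite[of "0::'a" r]
  by (simp add: set_lebesgue_integral_def)

text \<open>On a thin shell \<open>g\<close> is replaced by its value at radius \<open>s\<close> in
  the same direction. The replacement contributes exactly the difference of the two powers times a
  fixed integral, and the error is at most \<open>e\<close> times the volume of the shell.\<close>

lemma set_integral_shell_estimate:
  fixes g :: "'a::euclidean_space \<Rightarrow> real"
  defines "H \<equiv> \<lambda>r. LINT z:ball 0 r|lborel. g z"
    and "V \<equiv> measure lborel (ball (0::'a) 1)"
  assumes g: "continuous_on (ball 0 1) g" and s: "\<bar>s\<bar> < 1"
    and ab: "0 < a" "a \<le> b" "b < 1"
    and close: "\<And>z. a \<le> norm z \<Longrightarrow> norm z < b \<Longrightarrow> \<bar>g z - g (s *\<^sub>R sgn z)\<bar> \<le> e"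
  shows "\<bar>H b - H a - (b ^ DIM('a) - a ^ DIM('a)) * (LINT z:ball 0 1|lborel. g (s *\<^sub>R sgn z))\<bar>
      \<le> e * V * (b ^ DIM('a) - a ^ DIM('a))"
proof -
  define q where "q = (LINT z:ball 0 1|lborel. g (s *\<^sub>R sgn z))"
  define d where "d z = g z - g (s *\<^sub>R sgn z)" for z
  have gint: "set_integrable lborel (ball 0 r) g" if "r < 1" for r
    using that by (intro set_integrable_ball_continuous continuous_on_subset[OF g]) auto
  note sint = set_integrable_ball_sgn[OF g s]
  have dint: "set_integrable lborel (ball 0 r) d" if "r < 1" for r
    unfolding d_def using gint[OF that] sint by (rule set_integral_diff)
  have d: "(LINT z:ball 0 r|lborel. d z) = H r - r ^ DIM('a) * q" if "0 < r" "r < 1" for r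
    unfolding d_def H_def q_def
    by (simp only: set_integral_diff(2)[OF gint[OF that(2)] sint]
        set_integral_ball_sgn_scale[OF g s that(1)])
  let ?A = "ball 0 b - ball 0 a :: 'a set"
  have un: "ball 0 b = ball 0 a \<union> ?A" using ab by auto
  have dA: "set_integrable lborel ?A d"
    by (rule set_integrable_subset[OF dint[OF ab(3)]]) auto
  have "(LINT z:ball 0 b|lborel. d z) = (LINT z:ball 0 a|lborel. d z) + (LINT z:?A|lborel. d z)"
    by (subst un, rule set_integral_Un) (use dA dint ab in auto)
  then have "H b - H a - (b ^ DIM('a) - a ^ DIM('a)) * q = (LINT z:?A|lborel. d z)"
    using d[of a] d[of b] ab by (simp add: algebra_simps)
  also have "\<bar>\<dots>\<bar> \<le> (LINT z:?A|lborel. \<bar>d z\<bar>)"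
    using set_integral_norm_bound[OF dA] by simp
  also have "\<dots> \<le> (LINT z:?A|lborel. e)"
  proof (rule set_integral_mono)
    have "set_integrable lborel (ball 0 b) (\<lambda>z::'a. e)"
      by (rule set_integrable_ball_continuous) auto
    then show "set_integrable lborel ?A (\<lambda>z. e)"
      by (rule set_integrable_subset) auto
    show "\<bar>d z\<bar> \<le> e" if "z \<in> ?A" for z
      using close[of z] that by (auto simp: d_def)
  qed (rule set_integrable_abs[OF dA])
  also have "\<dots> = (LINT z:ball (0::'a) b|lborel. e) - (LINT z:ball (0::'a) a|lborel. e)"
  proof -
    have "(LINT z:ball (0::'a) b|lborel. e) = (LINT z:ball (0::'a) a|lborel. e) + (LINT z:?A|lborel. e)"
      by (subst un, rule set_integral_Un)
         (auto intro!: set_integrable_subset[OF set_integrable_ball_continuous[of b "\<lambda>_. e"]]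
            set_integrable_ball_continuous)
    then show ?thesis by simp
  qed
  also have "\<dots> = e * V * (b ^ DIM('a) - a ^ DIM('a))"
    using ab content_ball_conv_unit_ball[of b "0::'a"] content_ball_conv_unit_ball[of a "0::'a"]
    by (simp add: set_integral_const_ball V_def algebra_simps)
  finally show ?thesis unfolding q_def .
qed

text \<open>With \<open>q\<close> the integral of \<open>g\<close> frozen at radius
  \<open>s\<close>, the shell estimate shows that the ball integral minus \<open>r ^ n * q\<close>
  has derivative 0 at \<open>s\<close>; the derivative is therefore that of the power.\<close>

lemma set_integral_ball_has_derivative:
  fixes g :: "'a::euclidean_space \<Rightarrow> real"
  assumes g: "continuous_on (ball 0 1) g" and s: "0 < s" "s < 1"
  shows "((\<lambda>r. LINT z:ball 0 r|lborel. g z) has_real_derivative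
      real DIM('a) * s ^ (DIM('a) - 1) * (LINT z:ball 0 1|lborel. g (s *\<^sub>R sgn z))) (at s)"
proof -
  define H where "H = (\<lambda>r. LINT z:ball 0 r|lborel. g z)"
  define V where "V = measure lborel (ball (0::'a) 1)"
  define q where "q = (LINT z:ball 0 1|lborel. g (s *\<^sub>R sgn z))"
  define n where "n = DIM('a)"
  have V: "0 < V" unfolding V_def by (simp add: content_ball_pos)
  have n: "0 < n" unfolding n_def by simp
  have "((\<lambda>r. H r - r ^ n * q) has_derivative (\<lambda>_. 0)) (at s)"
    unfolding has_derivative_at_alt
  proof (intro conjI allI impI)
    fix e :: real assume e: "0 < e"
    \<comment> \<open>The shell has volume at most \<open>V * n * \<bar>y - s\<bar>\<close>, since
      the n-th power is n-Lipschitz on the unit interval.\<close>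
    define e' where "e' = e / (V * n)"
    have e': "0 < e'" using e V n by (simp add: e'_def)
    \<comment> \<open>A radius strictly between \<open>s\<close> and 1 keeps all shells in a compact
      ball, where \<open>g\<close> is uniformly continuous.\<close>
    define R where "R = (1 + s) / 2"
    have R: "s < R" "R < 1" using s by (auto simp: R_def)
    have "uniformly_continuous_on (cball 0 R) g"
      using R by (intro compact_uniformly_continuous continuous_on_subset[OF g]) auto
    then obtain \<delta> where \<delta>: "0 < \<delta>"
      "\<And>z w. z \<in> cball 0 R \<Longrightarrow> w \<in> cball 0 R \<Longrightarrow> dist w z < \<delta> \<Longrightarrow> dist (g w) (g z) < e'"
      unfolding uniformly_continuous_on_def using e' by metis
    define d where "d = min \<delta> (min s (R - s))"
    have "0 < d" using \<delta> s R by (simp add: d_def)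
    moreover have "norm (H y - y ^ n * q - (H s - s ^ n * q) - 0) \<le> e * norm (y - s)"
      if y: "norm (y - s) < d" for y
    proof -
      have y0: "0 < y" "y < R" "\<bar>y - s\<bar> < \<delta>" using y by (auto simp: d_def)
      \<comment> \<open>Ordering the two radii lets one shell estimate serve increments of either
        sign.\<close>
      define a where "a = min y s"
      define b where "b = max y s"
      have *: "\<bar>H b - H a - (b ^ n - a ^ n) * q\<bar> \<le> e' * V * (b ^ n - a ^ n)"
        unfolding H_def V_def n_def q_def
      proof (rule set_integral_shell_estimate[OF g])
        show "\<bar>g z - g (s *\<^sub>R sgn z)\<bar> \<le> e'" if z: "a \<le> norm z" "norm z < b" for z :: 'a
        proof -
          have zn: "z = norm z *\<^sub>R sgn z"
            by (cases "z = 0") (simp_all add: sgn_div_norm)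
          have "dist z (s *\<^sub>R sgn z) = norm ((norm z - s) *\<^sub>R sgn z)"
            by (subst zn) (simp only: dist_norm scaleR_diff_left)
          also have "\<dots> \<le> \<bar>norm z - s\<bar>" by (rule norm_scaleR_sgn_le)
          also have "\<dots> < \<delta>" using z y0 by (auto simp: a_def b_def)
          finally have "dist (g z) (g (s *\<^sub>R sgn z)) < e'"
          proof (intro \<delta>(2))
            have "norm (s *\<^sub>R sgn z) \<le> R"
              using norm_scaleR_sgn_le[of s z] s R by linarith
            then show "s *\<^sub>R sgn z \<in> cball 0 R" by simp
            have "norm z < R" using z y0 R by (simp add: b_def)
            then show "z \<in> cball 0 R" by simp
          qed
          then show ?thesis by (simp add: dist_norm)
        qed
      qed (use s y0 R in \<open>auto simp: a_def b_def\<close>)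
      have "\<bar>b ^ n - a ^ n\<bar> \<le> real n * \<bar>y - s\<bar>"
        using norm_power_diff[of b a n] s y0 R by (cases "y \<le> s") (simp_all add: a_def b_def)
      then have le2: "e' * V * \<bar>b ^ n - a ^ n\<bar> \<le> e' * V * (real n * \<bar>y - s\<bar>)"
        using e' V by (intro mult_left_mono) auto
      have "\<bar>H y - H s - (y ^ n - s ^ n) * q\<bar> \<le> e' * V * \<bar>b ^ n - a ^ n\<bar>"
      proof (cases "y \<le> s")
        case True
        then have "y ^ n \<le> s ^ n" using y0 by (simp add: power_mono)
        moreover have "\<bar>H y - H s - (y ^ n - s ^ n) * q\<bar> = \<bar>H s - H y - (s ^ n - y ^ n) * q\<bar>"
          by (subst abs_minus_cancel[symmetric]) (simp add: algebra_simps)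
        ultimately show ?thesis
          using True * by (simp add: a_def b_def)
      next
        case False
        then have "s ^ n \<le> y ^ n" using s by (simp add: power_mono)
        then show ?thesis
          using False * by (simp add: a_def b_def)
      qed
      also note le2
      also have "e' * V * (real n * \<bar>y - s\<bar>) = e * \<bar>y - s\<bar>"
        using V n by (simp add: e'_def)
      also have "H y - H s - (y ^ n - s ^ n) * q = H y - y ^ n * q - (H s - s ^ n * q) - 0"
        by (simp add: algebra_simps)
      finally show ?thesis by simp
    qed
    ultimately show "\<exists>d>0. \<forall>y. norm (y - s) < d \<longrightarrow>
        norm (H y - y ^ n * q - (H s - s ^ n * q) - 0) \<le> e * norm (y - s)"
      by blast
  qed (auto intro: bounded_linear_zero)
  then have "((\<lambda>r. H r - r ^ n * q) has_real_derivative 0) (at s)"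
    by (simp add: has_field_derivative_def mult_zero_left[abs_def])
  then have "((\<lambda>r. (H r - r ^ n * q) + r ^ n * q) has_real_derivative 0 + real n * s ^ (n - 1) * q) (at s)"
    by (rule DERIV_add) (auto intro!: derivative_eq_intros)
  then show ?thesis by (simp add: H_def n_def q_def)
qed

lemma set_integral_sum:
  fixes f :: "'i \<Rightarrow> 'a \<Rightarrow> 'b::{banach, second_countable_topology}"
  assumes "\<And>i. i \<in> I \<Longrightarrow> set_integrable M A (f i)"
  shows "(LINT x:A|M. (\<Sum>i\<in>I. f i x)) = (\<Sum>i\<in>I. LINT x:A|M. f i x)"
  using assms unfolding set_lebesgue_integral_def set_integrable_def scaleR_sum_right
  by (rule Bochner_Integration.integral_sum)

section \<open>Sphere means of functions with nonnegative Laplacian\<close>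

text \<open>Derivatives are kept as plain functions of their directions, so that each component can
  be integrated separately. In \<open>D2u z h b\<close> the first derivative is taken along
  \<open>b\<close> and then differentiated along \<open>h\<close>.\<close>

locale C2_unit_ball =
  fixes u :: "'a::euclidean_space \<Rightarrow> real"
    and Du :: "'a \<Rightarrow> 'a \<Rightarrow> real"
    and D2u :: "'a \<Rightarrow> 'a \<Rightarrow> 'a \<Rightarrow> real"
  assumes has_derivative_u: "z \<in> ball 0 1 \<Longrightarrow> (u has_derivative Du z) (at z)"
    and has_derivative_Du: "z \<in> ball 0 1 \<Longrightarrow> ((\<lambda>x. Du x b) has_derivative (\<lambda>h. D2u z h b)) (at z)"
    and continuous_on_D2u: "continuous_on (ball 0 1) (\<lambda>z. D2u z h b)"
begin

definition lap :: "'a \<Rightarrow> real" where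
  "lap z = (\<Sum>b\<in>Basis. D2u z b b)"

text \<open>Up to the volume of the unit ball, the mean of \<open>u\<close> over the sphere of radius \<open>r\<close>.\<close>
definition mean :: "real \<Rightarrow> real" where
  "mean r = (LINT z:ball 0 1|lborel. u (r *\<^sub>R sgn z))"

text \<open>Up to the same volume factor, the sphere mean of \<open>r\<close> times the radial
  derivative of \<open>u\<close>.\<close>

definition flux :: "real \<Rightarrow> real" where
  "flux r = (LINT z:ball 0 1|lborel. Du (r *\<^sub>R sgn z) (r *\<^sub>R sgn z))"

text \<open>Half of the weighted Laplacian integral over the ball of radius
  \<open>s\<close>.\<close>

definition radial :: "real \<Rightarrow> real" where
  "radial s = (LINT z:ball 0 s|lborel. Du z z)"

lemma linear_Du: "z \<in> ball 0 1 \<Longrightarrow> linear (Du z)"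
  using has_derivative_u has_derivative_linear by blast

lemma linear_D2u: "z \<in> ball 0 1 \<Longrightarrow> linear (\<lambda>h. D2u z h b)"
  using has_derivative_Du has_derivative_linear by blast

lemma Du_eq_sum:
  assumes "z \<in> ball 0 1"
  shows "Du z h = (\<Sum>b\<in>Basis. (h \<bullet> b) * Du z b)"
proof -
  have "Du z h = Du z (\<Sum>b\<in>Basis. (h \<bullet> b) *\<^sub>R b)"
    by (subst euclidean_representation) (rule refl)
  also have "\<dots> = (\<Sum>b\<in>Basis. (h \<bullet> b) * Du z b)"
    using linear_Du[OF assms] by (simp add: linear_sum linear_cmul)
  finally show ?thesis .
qed

lemma continuous_on_u: "continuous_on (ball 0 1) u"
  by (rule has_derivative_continuous_on) (blast intro: has_derivative_at_withinI has_derivative_u)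

lemma continuous_on_Du: "continuous_on (ball 0 1) (\<lambda>z. Du z b)"
  by (rule has_derivative_continuous_on) (blast intro: has_derivative_at_withinI has_derivative_Du)

lemma continuous_on_lap: "continuous_on (ball 0 1) lap"
  unfolding lap_def by (intro continuous_intros continuous_on_D2u)

lemma continuous_on_Du_self: "continuous_on (ball 0 1) (\<lambda>z. Du z z)"
proof -
  have "continuous_on (ball 0 1) (\<lambda>z. \<Sum>b\<in>Basis. (z \<bullet> b) * Du z b)"
    by (intro continuous_intros continuous_on_Du)
  then show ?thesis
    by (rule continuous_on_eq) (simp add: Du_eq_sum)
qed

lemma set_integral_weighted_laplacian:
  assumes s: "0 < s" "s < 1"
  shows "(LINT z:ball 0 s|lborel. (s\<^sup>2 - (norm z)\<^sup>2) * lap z) = 2 * radial s"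
proof -
  have sub: "cball 0 s \<subseteq> ball (0::'a) 1" using s by auto
  have cDu: "continuous_on (cball 0 s) (\<lambda>z. Du z b)" for b
    by (rule continuous_on_subset[OF continuous_on_Du sub])
  have cD2u: "continuous_on (cball 0 s) (\<lambda>z. D2u z h b)" for h b
    by (rule continuous_on_subset[OF continuous_on_D2u sub])
  \<comment> \<open>The full derivative at \<open>z\<close>, in direction \<open>h\<close>, of
    \<open>(s\<^sup>2 - z \<bullet> z) * Du z b\<close>. Only its value at \<open>h = b\<close> is
    integrated; summing over the basis assembles \<open>lap z\<close> on one side and
    \<open>Du z z\<close> on the other.\<close>
  let ?F' = "\<lambda>b z h. (s\<^sup>2 - z \<bullet> z) * D2u z h b - 2 * ((z \<bullet> h) * Du z b)"
  have zero: "(LINT z:ball 0 s|lborel. ?F' b z b) = 0" for b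
  proof -
    have lin: "linear (?F' b z)" if "z \<in> cball 0 s" for z
    proof -
      interpret linear "\<lambda>h. D2u z h b" using that sub by (intro linear_D2u) auto
      show ?thesis by (rule linearI) (simp_all add: add scaleR algebra_simps)
    qed
    have cont: "continuous_on (cball 0 s) (\<lambda>z. ?F' b z h)" for h
      by (intro continuous_intros cDu cD2u)
    obtain L where L: "\<And>z h. z \<in> cball 0 s \<Longrightarrow> \<bar>?F' b z h\<bar> \<le> L * norm h"
      by (rule linear_functionals_bounded_on_compact[of "cball 0 s" "?F' b"]) (use lin cont in auto)
    show ?thesis
    proof (rule set_integral_ball_derivative_eq_0[OF s(1),
          where F = "\<lambda>z. (s\<^sup>2 - z \<bullet> z) * Du z b" and F' = "?F' b" and L = L])
      fix z :: 'a assume z: "norm z \<le> s"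
      then have "z \<in> ball 0 1" using s by auto
      note [derivative_intros] = has_derivative_Du[OF this]
      show "((\<lambda>z. (s\<^sup>2 - z \<bullet> z) * Du z b) has_derivative ?F' b z) (at z)"
        by (auto intro!: derivative_eq_intros simp: fun_eq_iff algebra_simps inner_commute)
    next
      fix z :: 'a assume "norm z = s"
      then show "(s\<^sup>2 - z \<bullet> z) * Du z b = 0" by (simp add: dot_square_norm)
    qed (use L cont in auto)
  qed
  have I1: "set_integrable lborel (ball 0 s) (\<lambda>z. (s\<^sup>2 - (norm z)\<^sup>2) * D2u z b b)" for b
    by (intro set_integrable_ball_continuous continuous_intros cD2u)
  have I2: "set_integrable lborel (ball 0 s) (\<lambda>z. 2 * ((z \<bullet> b) * Du z b))" for b
    by (intro set_integrable_ball_continuous continuous_intros cDu)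
  have eq: "(LINT z:ball 0 s|lborel. (s\<^sup>2 - (norm z)\<^sup>2) * D2u z b b)
      = (LINT z:ball 0 s|lborel. 2 * ((z \<bullet> b) * Du z b))" for b
    using zero[of b] set_integral_diff(2)[OF I1[of b] I2[of b]] by (simp add: dot_square_norm)
  have "(LINT z:ball 0 s|lborel. (s\<^sup>2 - (norm z)\<^sup>2) * lap z)
      = (LINT z:ball 0 s|lborel. (\<Sum>b\<in>Basis. (s\<^sup>2 - (norm z)\<^sup>2) * D2u z b b))"
    by (simp add: lap_def sum_distrib_left)
  also have "\<dots> = (\<Sum>b\<in>Basis. LINT z:ball 0 s|lborel. (s\<^sup>2 - (norm z)\<^sup>2) * D2u z b b)"
    by (rule set_integral_sum) (rule I1)
  also have "\<dots> = (\<Sum>b\<in>Basis. LINT z:ball 0 s|lborel. 2 * ((z \<bullet> b) * Du z b))"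
    by (simp only: eq)
  also have "\<dots> = (LINT z:ball 0 s|lborel. (\<Sum>b\<in>Basis. 2 * ((z \<bullet> b) * Du z b)))"
    by (rule set_integral_sum[symmetric]) (rule I2)
  also have "\<dots> = (LINT z:ball 0 s|lborel. 2 * Du z z)"
  proof (intro set_lebesgue_integral_cong allI impI)
    fix z :: 'a assume "z \<in> ball 0 s"
    then have "z \<in> ball 0 1" using s by auto
    then show "(\<Sum>b\<in>Basis. 2 * ((z \<bullet> b) * Du z b)) = 2 * Du z z"
      by (simp only: sum_distrib_left[symmetric] Du_eq_sum[symmetric])
  qed simp
  finally show ?thesis by (simp add: radial_def)
qed

lemma has_derivative_radial:
  assumes "0 < s" "s < 1"
  shows "(radial has_real_derivative real DIM('a) * s ^ (DIM('a) - 1) * flux s) (at s)"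
  using set_integral_ball_has_derivative[OF continuous_on_Du_self assms]
  by (simp add: radial_def[abs_def] flux_def)

text \<open>Differentiation under the integral sign: the derivative of \<open>u\<close> along rays
  is uniformly continuous in radius and direction, so the difference quotients converge uniformly in
  the direction.\<close>

lemma has_derivative_mean:
  assumes s: "0 < s" "s < 1"
  shows "(mean has_real_derivative flux s / s) (at s)"
proof -
  define V where "V = measure lborel (ball (0::'a) 1)"
  have V: "0 < V" unfolding V_def by (simp add: content_ball_pos)
  \<comment> \<open>The derivative of \<open>u\<close> along the ray through \<open>w\<close>,
    written as a sum over the basis so that joint continuity in \<open>r\<close> and
    \<open>w\<close> is visible.\<close>
  define K where "K = (\<lambda>(r, w). \<Sum>b\<in>Basis. (w \<bullet> b) * Du (r *\<^sub>R w) b)"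
  define R where "R = (1 + s) / 2"
  have R: "s < R" "R < 1" using s by (auto simp: R_def)
  have in_ball: "r *\<^sub>R w \<in> ball 0 1" if "\<bar>r\<bar> < 1" "norm w \<le> 1" for r and w :: 'a
    using that mult_left_mono[of "norm w" 1 "\<bar>r\<bar>"] by simp
  have sgn1: "norm (sgn z) \<le> 1" for z :: 'a by (simp add: norm_sgn)
  have K: "K (r, w) = Du (r *\<^sub>R w) w" if "\<bar>r\<bar> < 1" "norm w \<le> 1" for r w
    unfolding K_def prod.case by (rule Du_eq_sum[OF in_ball[OF that], symmetric])
  \<comment> \<open>The second factor is the closed ball rather than the sphere because
    \<open>sgn 0 = 0\<close> has to be covered.\<close>
  have "continuous_on ({0..R} \<times> cball 0 1) K"
    unfolding K_def case_prod_beta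
  proof (intro continuous_intros)
    show "continuous_on ({0..R} \<times> cball 0 1) (\<lambda>x. Du (fst x *\<^sub>R snd x) b)" for b :: 'a
    proof (rule continuous_on_compose2[OF continuous_on_Du])
      show "(\<lambda>x. fst x *\<^sub>R snd x) ` ({0..R} \<times> cball 0 1) \<subseteq> ball (0::'a) 1"
      proof (rule image_subsetI)
        fix x :: "real \<times> 'a" assume "x \<in> {0..R} \<times> cball 0 1"
        then show "fst x *\<^sub>R snd x \<in> ball 0 1"
          using R by (intro in_ball) auto
      qed
    qed (intro continuous_intros)
  qed
  then have uK: "uniformly_continuous_on ({0..R} \<times> cball 0 1) K"
    by (intro compact_uniformly_continuous compact_Times) auto
  have Ks: "K (s, sgn z) = Du (s *\<^sub>R sgn z) (s *\<^sub>R sgn z) / s" for z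
    using s K[of s "sgn z"] linear_cmul[OF linear_Du[OF in_ball[of s "sgn z"]], of s "sgn z"] sgn1[of z]
    by simp
  have int_u: "set_integrable lborel (ball 0 1) (\<lambda>z. u (r *\<^sub>R sgn z))" if "\<bar>r\<bar> < 1" for r
    using set_integrable_ball_sgn[OF continuous_on_u that] .
  have int_K: "set_integrable lborel (ball 0 1) (\<lambda>z. K (s, sgn z))"
    unfolding Ks using set_integrable_ball_sgn[OF continuous_on_Du_self, of s] s by simp
  have "(LINT z:ball 0 1|lborel. K (s, sgn z)) = flux s / s"
    unfolding Ks flux_def by simp
  moreover have "(mean has_derivative (\<lambda>h. h * (LINT z:ball 0 1|lborel. K (s, sgn z)))) (at s)"
    unfolding has_derivative_at_alt
  proof (intro conjI allI impI)
    fix e :: real assume e: "0 < e"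
    then have "0 < e / V" using V by simp
    then obtain \<delta> where \<delta>: "0 < \<delta>"
      "\<And>x y. x \<in> {0..R} \<times> cball 0 1 \<Longrightarrow> y \<in> {0..R} \<times> cball 0 1 \<Longrightarrow> dist y x < \<delta> \<Longrightarrow> dist (K y) (K x) < e / V"
      using uK unfolding uniformly_continuous_on_def by metis
    define d where "d = min \<delta> (min s (R - s))"
    have "0 < d" using \<delta> s R by (simp add: d_def)
    moreover have "norm (mean y - mean s - (y - s) * (LINT z:ball 0 1|lborel. K (s, sgn z))) \<le> e * norm (y - s)"
      if y: "norm (y - s) < d" for y
    proof -
      have inR: "0 < t" "t < R" "\<bar>t - s\<bar> < \<delta>" if "t \<in> ball s d" for t
        using that by (auto simp: d_def dist_real_def)
      have yin: "y \<in> ball s d" using y by (simp add: dist_norm norm_minus_commute)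
      have sin: "s \<in> ball s d" using \<open>0 < d\<close> by simp
      have est: "\<bar>u (y *\<^sub>R sgn z) - u (s *\<^sub>R sgn z) - (y - s) * K (s, sgn z)\<bar> \<le> e / V * \<bar>y - s\<bar>" for z
      proof -
        \<comment> \<open>Mean value inequality for \<open>u\<close> along the ray minus its linear
          part at \<open>s\<close>; the derivative of this difference is
          \<open>K (t, sgn z) - K (s, sgn z)\<close>, which is small.\<close>
        have "norm ((u (y *\<^sub>R sgn z) - y * K (s, sgn z)) - (u (s *\<^sub>R sgn z) - s * K (s, sgn z)))
            \<le> e / V * norm (y - s)"
        proof (rule field_differentiable_bound[of "ball s d" _ "\<lambda>t. K (t, sgn z) - K (s, sgn z)"])
          fix t assume t: "t \<in> ball s d"
          have t1: "\<bar>t\<bar> < 1" using inR[OF t] R by simp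
          have "((\<lambda>t. t *\<^sub>R sgn z) has_derivative (\<lambda>h. h *\<^sub>R sgn z)) (at t)"
            by (rule derivative_eq_intros refl | simp)+
          then have "((\<lambda>t. u (t *\<^sub>R sgn z)) has_derivative (\<lambda>h. Du (t *\<^sub>R sgn z) (h *\<^sub>R sgn z))) (at t)"
            by (rule has_derivative_compose) (rule has_derivative_u[OF in_ball[OF t1 sgn1]])
          moreover have "(\<lambda>h. Du (t *\<^sub>R sgn z) (h *\<^sub>R sgn z)) = (*) (K (t, sgn z))"
            unfolding K[OF t1 sgn1] linear_cmul[OF linear_Du[OF in_ball[OF t1 sgn1]]]
            by (simp add: fun_eq_iff)
          ultimately have "((\<lambda>t. u (t *\<^sub>R sgn z)) has_field_derivative K (t, sgn z)) (at t)"
            by (simp add: has_field_derivative_def)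
          then have "((\<lambda>t. u (t *\<^sub>R sgn z) - t * K (s, sgn z)) has_field_derivative K (t, sgn z) - K (s, sgn z)) (at t)"
            by (auto intro!: derivative_eq_intros)
          then show "((\<lambda>t. u (t *\<^sub>R sgn z) - t * K (s, sgn z)) has_field_derivative
              K (t, sgn z) - K (s, sgn z)) (at t within ball s d)"
            by (rule has_field_derivative_at_within)
          have "dist (t, sgn z) (s, sgn z) < \<delta>"
            using inR[OF t] by (simp add: dist_Pair_Pair dist_real_def)
          then have "dist (K (t, sgn z)) (K (s, sgn z)) < e / V"
            using inR[OF t] s R sgn1[of z] by (intro \<delta>(2)) auto
          then show "norm (K (t, sgn z) - K (s, sgn z)) \<le> e / V"
            by (simp add: dist_norm)
        qed (use yin sin in auto)
        then show ?thesis by (simp add: algebra_simps)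
      qed
      have y1: "\<bar>y\<bar> < 1" and s1: "\<bar>s\<bar> < 1" using inR[OF yin] R s by auto
      note diff1 = set_integral_diff[OF int_u[OF y1] int_u[OF s1]]
      have int_K': "set_integrable lborel (ball 0 1) (\<lambda>z. (y - s) * K (s, sgn z))"
        using int_K by simp
      note diff2 = set_integral_diff[OF diff1(1) int_K']
      have "mean y - mean s - (y - s) * (LINT z:ball 0 1|lborel. K (s, sgn z))
          = (LINT z:ball 0 1|lborel. u (y *\<^sub>R sgn z) - u (s *\<^sub>R sgn z) - (y - s) * K (s, sgn z))"
        unfolding diff2(2) diff1(2) mean_def by simp
      also have "norm \<dots> \<le> (LINT z:ball 0 1|lborel. norm (u (y *\<^sub>R sgn z) - u (s *\<^sub>R sgn z) - (y - s) * K (s, sgn z)))"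
        by (rule set_integral_norm_bound[OF diff2(1)])
      also have "\<dots> \<le> (LINT z:ball (0::'a) 1|lborel. e / V * \<bar>y - s\<bar>)"
        using est set_integrable_abs[OF diff2(1)]
        by (intro set_integral_mono) (auto intro: set_integrable_ball_continuous)
      also have "\<dots> = e * \<bar>y - s\<bar>"
        using V by (simp add: set_integral_const_ball V_def)
      finally show ?thesis by simp
    qed
    ultimately show "\<exists>d>0. \<forall>y. norm (y - s) < d \<longrightarrow>
        norm (mean y - mean s - (y - s) * (LINT z:ball 0 1|lborel. K (s, sgn z))) \<le> e * norm (y - s)"
      by blast
  qed (rule bounded_linear_mult_left)
  ultimately have "(mean has_derivative (\<lambda>h. flux s / s * h)) (at s)"
    by (simp add: mult.commute)
  then show ?thesis
    by (simp only: has_field_derivative_def)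
qed

section \<open>Monotonicity, and comparison of the means with the weighted Laplacian
  integrals\<close>

lemma set_integrable_weighted_laplacian:
  assumes "r < 1"
  shows "set_integrable lborel (ball 0 r) (\<lambda>z. (r\<^sup>2 - (norm z)\<^sup>2) * lap z)"
  using assms
  by (intro set_integrable_ball_continuous continuous_intros continuous_on_subset[OF continuous_on_lap]) auto

text \<open>Twice \<open>radial s\<close> is the integral of \<open>lap\<close> against the positive
  part of \<open>s\<^sup>2 - (norm z)\<^sup>2\<close>, and this weight increases with
  \<open>s\<close>.\<close>

lemma radial_mono:
  assumes nonneg: "\<And>z. z \<in> ball 0 1 \<Longrightarrow> 0 \<le> lap z" and st: "0 < s" "s \<le> t" "t < 1"
  shows "radial s \<le> radial t"
proof -
  have int: "integrable lborel (\<lambda>z. indicator (ball 0 r) z *\<^sub>R ((r\<^sup>2 - (norm z)\<^sup>2) * lap z))"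
    if "r < 1" for r
    using set_integrable_weighted_laplacian[OF that] by (simp only: set_integrable_def)
  have "2 * radial s \<le> 2 * radial t"
    unfolding set_integral_weighted_laplacian[of s, symmetric, OF st(1) order_le_less_trans[OF st(2,3)]]
      set_integral_weighted_laplacian[of t, symmetric, OF order_less_le_trans[OF st(1,2)] st(3)]
    unfolding set_lebesgue_integral_def
  proof (rule integral_mono[OF int int])
    fix z :: 'a
    show "indicator (ball 0 s) z *\<^sub>R ((s\<^sup>2 - (norm z)\<^sup>2) * lap z)
        \<le> indicator (ball 0 t) z *\<^sub>R ((t\<^sup>2 - (norm z)\<^sup>2) * lap z)"
    proof (cases "z \<in> ball 0 t")
      case True
      then have "0 \<le> lap z" using st by (intro nonneg) auto
      moreover have "s\<^sup>2 \<le> t\<^sup>2" "(norm z)\<^sup>2 \<le> t\<^sup>2"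
        using st True by (auto intro!: power_mono)
      ultimately show ?thesis
        using True by (auto simp: indicator_def intro!: mult_right_mono)
    qed (use st in auto)
  qed (use st in auto)
  then show ?thesis by simp
qed

text \<open>The derivative of \<open>radial\<close> is a positive multiple of \<open>flux\<close>,
  so a negative value would force \<open>radial\<close> to drop strictly just to the right of
  \<open>s\<close>.\<close>

lemma flux_nonneg:
  assumes nonneg: "\<And>z. z \<in> ball 0 1 \<Longrightarrow> 0 \<le> lap z" and s: "0 < s" "s < 1"
  shows "0 \<le> flux s"
proof (rule ccontr)
  assume "\<not> 0 \<le> flux s"
  then have "real DIM('a) * s ^ (DIM('a) - 1) * flux s < 0"
    using s by (simp add: mult_pos_neg)
  from DERIV_neg_dec_right[OF has_derivative_radial[OF s] this]
  obtain d where d: "0 < d" "\<And>h. 0 < h \<Longrightarrow> h < d \<Longrightarrow> radial (s + h) < radial s"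
    by blast
  define h where "h = min (d / 2) ((1 - s) / 2)"
  have "0 < h" "h < d" "s + h < 1" using d(1) s by (auto simp: h_def min_def field_simps)
  then show False
    using d(2)[of h] radial_mono[OF nonneg, of s "s + h"] s by simp
qed

text \<open>The comparison with \<open>radial\<close> divides by a power of the radius and is made
  only from 1/2 on; smaller radii are covered by compactness.\<close>

lemma mean_bounded_below_half:
  obtains B where "\<And>r. 0 \<le> r \<Longrightarrow> r \<le> 1/2 \<Longrightarrow> mean r \<le> B"
proof -
  obtain B where B: "\<And>z. norm z \<le> 1/2 \<Longrightarrow> \<bar>u z\<bar> \<le> B"
    using bounded_on_smaller_cball[OF continuous_on_u, of "1/2"] by auto
  have "mean r \<le> (LINT z:ball (0::'a) 1|lborel. B)" if "0 \<le> r" "r \<le> 1/2" for r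
    unfolding mean_def
  proof (rule set_integral_mono)
    show "u (r *\<^sub>R sgn z) \<le> B" for z
      using B[of "r *\<^sub>R sgn z"] norm_scaleR_sgn_le[of r z] that by simp
  qed (use that in \<open>auto intro: set_integrable_ball_sgn continuous_on_u set_integrable_ball_continuous\<close>)
  then show ?thesis by (rule that)
qed

text \<open>Since \<open>radial' = n r\<^sup>n mean'\<close>, both functions are bounded or unbounded together near radius 1.\<close>

lemma bdd_above_mean_iff_radial:
  assumes nonneg: "\<And>z. z \<in> ball 0 1 \<Longrightarrow> 0 \<le> lap z"
    and u0: "\<And>z. z \<in> ball 0 1 \<Longrightarrow> 0 \<le> u z"
  shows "bdd_above (mean ` {0<..<1}) \<longleftrightarrow> bdd_above (radial ` {1/2..<1})"
proof -
  let ?n = "DIM('a)"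
  have n: "0 < ?n" by simp
  have pow: "s ^ ?n = s * s ^ (?n - 1)" for s :: real
    using n by (simp add: power_eq_if)
  have d1: "bdd_above (radial ` {1/2..<1})" if "bdd_above (mean ` {0<..<1})"
  proof -
    from that obtain B where "\<forall>r\<in>{0<..<1}. mean r \<le> B"
      by (auto simp: bdd_above_def)
    then have B: "mean r \<le> B" if "0 < r" "r < 1" for r
      using that by simp
    have mean0: "0 \<le> mean r" if "0 < r" "r < 1" for r
      unfolding mean_def set_lebesgue_integral_def
    proof (intro Bochner_Integration.integral_nonneg scaleR_nonneg_nonneg u0)
      show "r *\<^sub>R sgn z \<in> ball 0 1" for z :: 'a
        using that by (intro scaleR_sgn_in_ball) simp
    qed simp
    \<comment> \<open>The subtracted product is chosen so that the \<open>flux\<close> terms cancel: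
      what remains of the derivative is \<open>- n\<^sup>2 * t ^ (n - 1) * mean t\<close>, with
      \<open>n\<close> the dimension, which is nonpositive.\<close>
    define E where "E = (\<lambda>s::real. radial s - real ?n * s ^ ?n * mean s)"
    have "radial s \<le> real ?n * B + \<bar>E (1/2)\<bar>" if s: "1/2 \<le> s" "s < 1" for s
    proof -
      have "E s \<le> E (1/2)"
      proof (rule DERIV_nonpos_imp_nonincreasing[OF s(1)])
        fix t assume t: "1/2 \<le> t" "t \<le> s"
        then have t1: "0 < t" "t < 1" using s by auto
        have "(E has_real_derivative
            real ?n * t ^ (?n - 1) * flux t - (real ?n * (real ?n * t ^ (?n - 1)) * mean t + real ?n * t ^ ?n * (flux t / t))) (at t)"
          unfolding E_def
          by (rule derivative_eq_intros has_derivative_radial[OF t1] has_derivative_mean[OF t1] refl | simp)+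
        moreover have "real ?n * t ^ (?n - 1) * flux t - (real ?n * (real ?n * t ^ (?n - 1)) * mean t + real ?n * t ^ ?n * (flux t / t)) \<le> 0"
          using t1 mean0[OF t1] by (simp add: pow)
        ultimately show "\<exists>y. (E has_real_derivative y) (at t) \<and> y \<le> 0" by blast
      qed
      moreover have "s ^ ?n * mean s \<le> 1 * B"
        using s B[of s] mean0[of s] by (intro mult_mono) (auto simp: power_le_one)
      then have "real ?n * s ^ ?n * mean s \<le> real ?n * B"
        using n mult_left_mono[of "s ^ ?n * mean s" B "real ?n"] by (simp add: mult.assoc)
      ultimately show ?thesis unfolding E_def by linarith
    qed
    then show ?thesis
      by (intro bdd_aboveI2) auto
  qed
  have d2: "bdd_above (mean ` {0<..<1})" if "bdd_above (radial ` {1/2..<1})"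
  proof -
    from that obtain C where "\<forall>r\<in>{1/2..<1}. radial r \<le> C"
      by (auto simp: bdd_above_def)
    then have C: "radial r \<le> C" if "1/2 \<le> r" "r < 1" for r
      using that by simp
    obtain B where B: "\<And>r. 0 \<le> r \<Longrightarrow> r \<le> 1/2 \<Longrightarrow> mean r \<le> B"
      using mean_bounded_below_half by blast
    \<comment> \<open>Chosen so that \<open>K * n * t ^ n = (2 * t) ^ n\<close>, which is at least 1
      for \<open>t \<ge> 1/2\<close>; then \<open>K * radial\<close> grows at least as fast as
      \<open>mean\<close>.\<close>
    define K where "K = 2 ^ ?n / real ?n"
    have K: "0 < K" by (simp add: K_def)
    define E where "E = (\<lambda>s. K * radial s - mean s)"
    have "mean r \<le> \<bar>B\<bar> + K * \<bar>C\<bar> + K * \<bar>radial (1/2)\<bar>" if r: "0 < r" "r < 1" for r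
    proof (cases "r \<le> 1/2")
      case True
      then show ?thesis using B[of r] r K by (simp add: add_nonneg_nonneg algebra_simps add_increasing2)
    next
      case False
      then have "1/2 \<le> r" by simp
      then have "E (1/2) \<le> E r"
      proof (rule DERIV_nonneg_imp_nondecreasing)
        fix t assume t: "1/2 \<le> t" "t \<le> r"
        then have t1: "0 < t" "t < 1" using r by auto
        have "(E has_real_derivative K * (real ?n * t ^ (?n - 1) * flux t) - flux t / t) (at t)"
          unfolding E_def
          by (rule derivative_eq_intros has_derivative_radial[OF t1] has_derivative_mean[OF t1] refl | simp)+
        moreover have "K * (real ?n * t ^ (?n - 1) * flux t) - flux t / t = flux t / t * ((2 * t) ^ ?n - 1)"
          using t1 by (simp add: K_def power_mult_distrib pow field_simps)
        moreover have "1 \<le> (2 * t) ^ ?n" using t by (intro one_le_power) auto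
        ultimately show "\<exists>y. (E has_real_derivative y) (at t) \<and> 0 \<le> y"
          using flux_nonneg[OF nonneg t1] t1 by auto
      qed
      then have "mean r \<le> mean (1/2) + K * radial r - K * radial (1/2)"
        by (simp add: E_def)
      moreover have "K * radial r \<le> K * \<bar>C\<bar>" "- (K * radial (1/2)) \<le> K * \<bar>radial (1/2)\<bar>"
        using C[of r] r False K mult_left_mono[of "- radial (1/2)" "\<bar>radial (1/2)\<bar>" K] by auto
      ultimately show ?thesis using B[of "1/2"] by simp
    qed
    then show ?thesis
      by (intro bdd_aboveI2) auto
  qed
  show ?thesis by (rule iffI; (erule d1 | erule d2))
qed

text \<open>A pointwise bound by twice the integrand controls every \<open>radial s\<close>;
  conversely Fatou's lemma along radii tending to 1 recovers the full integral.\<close>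

lemma nn_integral_laplacian_finite_iff_radial:
  assumes nonneg: "\<And>z. z \<in> ball 0 1 \<Longrightarrow> 0 \<le> lap z"
  shows "(\<integral>\<^sup>+z\<in>ball 0 1. ennreal ((1 - norm z) * lap z) \<partial>lborel) < \<infinity>
      \<longleftrightarrow> bdd_above (radial ` {1/2..<1})"
proof -
  define W where "W = (\<integral>\<^sup>+z\<in>ball 0 1. ennreal ((1 - norm z) * lap z) \<partial>lborel)"
  have meas: "(\<lambda>z. indicator (ball 0 r) z * (c z * lap z)) \<in> borel_measurable borel"
    if "r \<le> 1" "continuous_on UNIV c" for r c
  proof -
    have "continuous_on (ball 0 r) (\<lambda>z. c z * lap z)"
      using that by (intro continuous_on_mult continuous_on_subset[OF continuous_on_lap]
          continuous_on_subset[OF that(2)]) auto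
    then show ?thesis
      using borel_measurable_continuous_on_indicator[of "ball 0 r" "\<lambda>z. c z * lap z"] by simp
  qed
  define k where "k s z = indicator (ball 0 s) z * ((s\<^sup>2 - (norm z)\<^sup>2) * lap z)" for s z
  have k_meas [measurable]: "k s \<in> borel_measurable borel" if "s \<le> 1" for s
    unfolding k_def[abs_def] using that by (intro meas continuous_intros)
  have k0: "0 \<le> k s z" if "s \<le> 1" for s z
  proof (cases "z \<in> ball 0 s")
    case True
    then have "(norm z)\<^sup>2 \<le> s\<^sup>2" by (intro power_mono) auto
    then show ?thesis using True nonneg[of z] that by (simp add: k_def)
  qed (simp add: k_def)
  have k_int: "(\<integral>\<^sup>+z. ennreal (k s z) \<partial>lborel) = ennreal (2 * radial s)" if s: "0 < s" "s < 1" for s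
  proof -
    have "integrable lborel (k s)"
      using set_integrable_weighted_laplacian[OF s(2)]
      by (simp add: k_def[abs_def] set_integrable_def)
    then have "(\<integral>\<^sup>+z. ennreal (k s z) \<partial>lborel) = ennreal (\<integral>z. k s z \<partial>lborel)"
      using k0 s by (intro nn_integral_eq_integral) auto
    also have "(\<integral>z. k s z \<partial>lborel) = 2 * radial s"
      using set_integral_weighted_laplacian[OF s]
      by (simp add: set_lebesgue_integral_def k_def)
    finally show ?thesis .
  qed
  have d1: "bdd_above (radial ` {1/2..<1})" if "W < \<infinity>"
  proof -
    have "2 * radial s \<le> enn2real (2 * W)" if s: "1/2 \<le> s" "s < 1" for s
    proof -
      have "ennreal (2 * radial s) = (\<integral>\<^sup>+z. ennreal (k s z) \<partial>lborel)"
        using s by (simp add: k_int)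
      also have "\<dots> \<le> (\<integral>\<^sup>+z. 2 * (ennreal ((1 - norm z) * lap z) * indicator (ball 0 1) z) \<partial>lborel)"
      proof (rule nn_integral_mono)
        fix z :: 'a
        show "ennreal (k s z) \<le> 2 * (ennreal ((1 - norm z) * lap z) * indicator (ball 0 1) z)"
        proof (cases "z \<in> ball 0 s")
          case True
          then have z: "z \<in> ball 0 1" using s by auto
          have "s\<^sup>2 - (norm z)\<^sup>2 \<le> 1 - (norm z)\<^sup>2"
            using s by (simp add: power_le_one)
          also have "\<dots> = (1 + norm z) * (1 - norm z)"
            by (simp add: power2_eq_square algebra_simps)
          also have "\<dots> \<le> 2 * (1 - norm z)"
            using z by (intro mult_right_mono) auto
          finally have "k s z \<le> 2 * ((1 - norm z) * lap z)"
            using True mult_right_mono[OF _ nonneg[OF z]] by (simp add: k_def mult.assoc[symmetric])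
          then have "ennreal (k s z) \<le> ennreal (2 * ((1 - norm z) * lap z))"
            by (rule ennreal_leI)
          then show ?thesis using z by (simp add: ennreal_mult')
        qed (simp add: k_def)
      qed
      also have "\<dots> = 2 * W"
      proof -
        have "(\<lambda>z. ennreal (indicator (ball 0 1) z * ((1 - norm z) * lap z))) \<in> borel_measurable borel"
          by (intro measurable_compose[OF meas measurable_ennreal] continuous_intros) simp
        also have "(\<lambda>z. ennreal (indicator (ball 0 1) z * ((1 - norm z) * lap z)))
            = (\<lambda>z. ennreal ((1 - norm z) * lap z) * indicator (ball 0 1) z)"
          by (auto simp: fun_eq_iff indicator_def)
        finally show ?thesis
          unfolding W_def by (intro nn_integral_cmult) simp
      qed
      finally have "ennreal (2 * radial s) \<le> 2 * W" .
      \<comment> \<open>\<open>enn2real\<close> sends infinity to 0, so finiteness is needed before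
        passing to real numbers.\<close>
      moreover have "2 * W < \<infinity>" using \<open>W < \<infinity>\<close> by (simp add: ennreal_mult_less_top)
      ultimately show ?thesis
        by (metis enn2real_ennreal enn2real_mono enn2real_nonneg infinity_ennreal_def linorder_le_cases order_trans)
    qed
    then have "radial s \<le> enn2real (2 * W) / 2" if "s \<in> {1/2..<1}" for s
      using that by fastforce
    then show ?thesis
      by (rule bdd_aboveI2)
  qed
  have d2: "W < \<infinity>" if "bdd_above (radial ` {1/2..<1})"
  proof -
    from that obtain C where "\<forall>r\<in>{1/2..<1}. radial r \<le> C"
      by (auto simp: bdd_above_def)
    then have C: "radial r \<le> C" if "1/2 \<le> r" "r < 1" for r
      using that by simp
    \<comment> \<open>The shift by 2 makes the sequence start at 1/2, inside the range where
      \<open>C\<close> is a bound.\<close>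
    define s where "s n = 1 - 1 / (real n + 2)" for n :: nat
    have s: "1/2 \<le> s n" "s n < 1" for n by (auto simp: s_def field_simps)
    have s1: "s \<longlonglongrightarrow> 1" unfolding s_def by real_asymp
    \<comment> \<open>A fixed \<open>z\<close> lies in the ball of radius \<open>s n\<close> for all
      large \<open>n\<close>, so the limit inferior is
      \<open>(1 - (norm z)\<^sup>2) * lap z\<close>, which dominates the integrand of
      \<open>W\<close>.\<close>
    have "W \<le> (\<integral>\<^sup>+z. liminf (\<lambda>n. ennreal (k (s n) z)) \<partial>lborel)"
      unfolding W_def
    proof (rule nn_integral_mono)
      fix z :: 'a
      show "ennreal ((1 - norm z) * lap z) * indicator (ball 0 1) z \<le> liminf (\<lambda>n. ennreal (k (s n) z))"
      proof (cases "z \<in> ball 0 1")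
        case True
        have "\<forall>\<^sub>F n in sequentially. norm z < s n"
          using order_tendstoD(1)[OF s1] True by simp
        then have ev: "\<forall>\<^sub>F n in sequentially. ((s n)\<^sup>2 - (norm z)\<^sup>2) * lap z = k (s n) z"
          by eventually_elim (simp add: k_def)
        have "(\<lambda>n. ((s n)\<^sup>2 - (norm z)\<^sup>2) * lap z) \<longlonglongrightarrow> (1\<^sup>2 - (norm z)\<^sup>2) * lap z"
          by (intro tendsto_intros s1)
        then have "(\<lambda>n. k (s n) z) \<longlonglongrightarrow> (1 - (norm z)\<^sup>2) * lap z"
          using Lim_transform_eventually[OF _ ev] by simp
        then have "liminf (\<lambda>n. ennreal (k (s n) z)) = ennreal ((1 - (norm z)\<^sup>2) * lap z)"
          by (intro lim_imp_Liminf tendsto_ennrealI) auto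
        moreover have "(norm z)\<^sup>2 \<le> norm z"
          using True by (simp add: power2_eq_square mult_left_le)
        then have "(1 - norm z) * lap z \<le> (1 - (norm z)\<^sup>2) * lap z"
          using nonneg[OF True] by (intro mult_right_mono) auto
        ultimately show ?thesis using True by (simp add: ennreal_leI)
      qed simp
    qed
    also have "\<dots> \<le> liminf (\<lambda>n. \<integral>\<^sup>+z. ennreal (k (s n) z) \<partial>lborel)"
      using s by (intro nn_integral_liminf) (auto intro!: measurable_compose[OF _ measurable_ennreal] k_meas less_imp_le)
    also have "\<dots> \<le> liminf (\<lambda>n::nat. ennreal (2 * C))"
    proof (intro Liminf_mono eventuallyI)
      fix n
      have "0 < s n" using s(1)[of n] by linarith
      then show "(\<integral>\<^sup>+z. ennreal (k (s n) z) \<partial>lborel) \<le> ennreal (2 * C)"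
        using s[of n] C[of "s n"] by (simp add: k_int ennreal_leI)
    qed
    also have "\<dots> < \<infinity>" by (simp add: Liminf_const)
    finally show ?thesis .
  qed
  show ?thesis unfolding W_def[symmetric] by (rule iffI; (erule d1 | erule d2))
qed

theorem nn_integral_laplacian_finite_iff_mean:
  assumes "\<And>z. z \<in> ball 0 1 \<Longrightarrow> 0 \<le> lap z" "\<And>z. z \<in> ball 0 1 \<Longrightarrow> 0 \<le> u z"
  shows "(\<integral>\<^sup>+z\<in>ball 0 1. ennreal ((1 - norm z) * lap z) \<partial>lborel) < \<infinity>
      \<longleftrightarrow> bdd_above (mean ` {0<..<1})"
  using nn_integral_laplacian_finite_iff_radial[OF assms(1)] bdd_above_mean_iff_radial[OF assms]
  by simp

end

section \<open>Powers of the norm of a C2 function\<close>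

text \<open>Growth of order above 1 is o(|h|). This settles the origin, where differentiating
  through the norm is impossible.\<close>

lemma has_derivative_zero_at_0:
  fixes F :: "'a::real_normed_vector \<Rightarrow> 'b::real_normed_vector"
  assumes q: "1 < q" and bound: "\<And>h. norm (F h) \<le> norm h powr q"
  shows "(F has_derivative (\<lambda>_. 0)) (at 0)"
  unfolding has_derivative_at_alt
proof (intro conjI allI impI)
  fix e :: real assume e: "0 < e"
  have "F 0 = 0" using bound[of 0] by simp
  \<comment> \<open>The solution of \<open>d powr (q - 1) = e\<close>.\<close>
  define d where "d = e powr (1 / (q - 1))"
  have "norm (F h) \<le> e * norm h" if "norm h < d" for h
  proof (cases "h = 0")
    case False
    have "norm h powr (q - 1) \<le> d powr (q - 1)"
      using that q by (intro powr_mono2) auto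
    also have "\<dots> = e"
      using q e by (simp add: d_def powr_powr)
    finally have le: "norm h powr (q - 1) \<le> e" .
    have "norm (F h) \<le> norm h powr (q - 1) * norm h"
      using bound[of h] False powr_add[of "norm h" "q - 1" 1] by simp
    also have "\<dots> \<le> e * norm h"
      using le by (intro mult_right_mono) auto
    finally show ?thesis .
  qed (simp add: \<open>F 0 = 0\<close>)
  then show "\<exists>d>0. \<forall>y. norm (y - 0) < d \<longrightarrow> norm (F y - F 0 - 0) \<le> e * norm (y - 0)"
    using e \<open>F 0 = 0\<close> by (intro exI[of _ d]) (auto simp: d_def)
qed (rule bounded_linear_zero)

lemma has_derivative_norm_powr:
  fixes w :: "'a::real_inner"
  assumes "w \<noteq> 0"
  shows "((\<lambda>w. norm w powr a) has_derivative (\<lambda>h. a * norm w powr (a - 2) * (w \<bullet> h))) (at w)"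
proof -
  have "((\<lambda>w. norm w powr a) has_derivative (\<lambda>h. (a * norm w powr (a - 1)) * (h \<bullet> sgn w))) (at w)"
    by (rule has_derivative_compose[OF has_derivative_norm[OF assms]])
       (use assms in \<open>auto intro!: has_real_derivative_powr simp: has_field_derivative_def[symmetric]\<close>)
  moreover have "a * norm w powr (a - 1) * (h \<bullet> sgn w) = a * norm w powr (a - 2) * (w \<bullet> h)" for h
  proof -
    have "norm w powr (a - 1) = norm w powr (a - 2) * norm w"
      using assms powr_add[of "norm w" "a - 2" 1] by simp
    then show ?thesis using assms by (simp add: sgn_div_norm inner_commute field_simps)
  qed
  ultimately show ?thesis by simp
qed

text \<open>For \<open>p \<ge> 2\<close> the Hessian of \<open>w \<mapsto> \<bar>w\<bar>\<^sup>p\<close> is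
  \<open>p (e I + (p - 2) S S\<^sup>T)\<close> with the following \<open>e\<close> and \<open>S\<close>, both continuous.
  The case distinction is needed because \<open>0 powr 0 = 0\<close>.\<close>

definition hess_scale :: "real \<Rightarrow> 'a::real_normed_vector \<Rightarrow> real" where
  "hess_scale p w = (if p = 2 then 1 else norm w powr (p - 2))"

definition hess_dir :: "real \<Rightarrow> 'a::real_normed_vector \<Rightarrow> 'a" where
  "hess_dir p w = (if p = 2 then 0 else norm w powr (p / 2 - 2) *\<^sub>R w)"

lemma hess_scale_nonneg: "0 \<le> hess_scale p w"
  by (simp add: hess_scale_def)

lemma continuous_on_hess_scale:
  assumes "2 \<le> p"
  shows "continuous_on UNIV (hess_scale p)"
proof (cases "p = 2")
  case False
  then have "continuous_on UNIV (\<lambda>w::'a. norm w powr (p - 2))"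
    using assms by (intro continuous_on_powr' continuous_intros) auto
  then show ?thesis using False by (simp add: hess_scale_def[abs_def])
qed (simp add: hess_scale_def[abs_def])

text \<open>The factor |w|^(p-4) in the Hessian may blow up at 0. Split evenly between the two
  copies of \<open>w\<close>, it leaves vectors of norm |w|^(p/2-1), which tends to 0 for p >
  2.\<close>

lemma continuous_on_hess_dir:
  assumes "2 \<le> p"
  shows "continuous_on UNIV (hess_dir p :: 'a::real_normed_vector \<Rightarrow> 'a)"
proof (cases "p = 2")
  case p: False
  have eq: "hess_dir p = (\<lambda>w::'a. norm w powr (p / 2 - 2) *\<^sub>R w)"
    using p by (simp add: hess_dir_def[abs_def])
  have "isCont (hess_dir p) w" for w :: 'a
  proof (cases "w = 0")
    case True
    have "norm (hess_dir p v) = norm v powr (p / 2 - 1)" for v :: 'a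
      using powr_add[of "norm v" "p / 2 - 2" 1] by (simp add: eq)
    moreover have "continuous_on UNIV (\<lambda>v::'a. norm v powr (p / 2 - 1))"
      using assms p by (intro continuous_on_powr' continuous_intros) auto
    then have "((\<lambda>v::'a. norm v powr (p / 2 - 1)) \<longlongrightarrow> 0) (at 0)"
      by (auto simp: continuous_on_def dest: spec[of _ 0])
    ultimately have "(hess_dir p \<longlongrightarrow> 0) (at (0::'a))"
      by (intro tendsto_norm_zero_cancel[of "hess_dir p"]) simp
    then show ?thesis
      using True p by (simp add: isCont_def hess_dir_def)
  next
    case False
    then show ?thesis unfolding eq by (intro continuous_intros) auto
  qed
  then show ?thesis by (simp add: continuous_on_eq_continuous_at)
qed (simp add: hess_dir_def[abs_def])

lemma has_derivative_norm_powr_ge_2: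
  fixes w :: "'a::real_inner"
  assumes "2 \<le> p"
  shows "((\<lambda>w. norm w powr p) has_derivative (\<lambda>h. p * (hess_scale p w *\<^sub>R w \<bullet> h))) (at w)"
proof (cases "w = 0")
  case True
  have "((\<lambda>w::'a. norm w powr p) has_derivative (\<lambda>_. 0)) (at 0)"
    by (rule has_derivative_zero_at_0[of p]) (use assms in auto)
  then show ?thesis using True by simp
next
  case False
  then have "hess_scale p w = norm w powr (p - 2)"
    by (simp add: hess_scale_def)
  then show ?thesis
    using has_derivative_norm_powr[OF False, of p] by (simp only: inner_scaleR_left mult.assoc)
qed

text \<open>For p = 2 the map is the identity. For p > 2 it has norm |w|^(p-1) with p - 1 > 1, so
  its derivative at 0 is zero, in agreement with the formula; elsewhere the product rule
  applies.\<close>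

lemma has_derivative_hess_scale_scaleR:
  fixes w :: "'a::real_inner"
  assumes "2 \<le> p"
  shows "((\<lambda>w. hess_scale p w *\<^sub>R w) has_derivative
      (\<lambda>h. hess_scale p w *\<^sub>R h + ((p - 2) * (hess_dir p w \<bullet> h)) *\<^sub>R hess_dir p w)) (at w)"
proof (cases "p = 2")
  case True
  then show ?thesis by (simp add: hess_scale_def)
next
  case p: False
  show ?thesis
  proof (cases "w = 0")
    case True
    have "((\<lambda>w::'a. norm w powr (p - 2) *\<^sub>R w) has_derivative (\<lambda>_. 0)) (at 0)"
    proof (rule has_derivative_zero_at_0[of "p - 1"])
      show "norm (norm h powr (p - 2) *\<^sub>R h) \<le> norm h powr (p - 1)" for h :: 'a
        using powr_add[of "norm h" "p - 2" 1] by simp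
    qed (use assms p in auto)
    then show ?thesis using True p by (simp add: hess_scale_def hess_dir_def)
  next
    case False
    have sq: "norm w powr (p / 2 - 2) * norm w powr (p / 2 - 2) = norm w powr (p - 4)"
      using powr_add[of "norm w" "p / 2 - 2" "p / 2 - 2"] by simp
    have "((\<lambda>w. norm w powr (p - 2) *\<^sub>R w) has_derivative
        (\<lambda>h. norm w powr (p - 2) *\<^sub>R h + ((p - 2) * norm w powr (p - 2 - 2) * (w \<bullet> h)) *\<^sub>R w)) (at w)"
      by (rule has_derivative_scaleR[OF has_derivative_norm_powr[OF False] has_derivative_ident])
    moreover have "((p - 2) * norm w powr (p - 2 - 2) * (w \<bullet> h)) *\<^sub>R w
        = ((p - 2) * (hess_dir p w \<bullet> h)) *\<^sub>R hess_dir p w" for h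
      using p sq by (simp add: hess_dir_def mult_ac)
    ultimately show ?thesis using p by (simp add: hess_scale_def)
  qed
qed

text \<open>The inner \<open>vector_derivative\<close> agrees with \<open>Dg\<close> only while the
  line through \<open>z\<close> stays in \<open>S\<close>. That is an open set of parameters around
  0, which is enough for the outer derivative at 0.\<close>

lemma laplacian_eq_sum:
  fixes g :: "'a::euclidean_space \<Rightarrow> 'b::real_normed_vector"
  assumes S: "open S" "z \<in> S"
    and Dg: "\<And>x. x \<in> S \<Longrightarrow> (g has_derivative Dg x) (at x)"
    and D2g: "\<And>b. ((\<lambda>x. Dg x b) has_derivative (\<lambda>h. D2g h b)) (at z)"
  shows "laplacian g z = (\<Sum>b\<in>Basis. D2g b b)"
  unfolding laplacian_def
proof (rule sum.cong[OF refl])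
  fix b :: 'a
  have line: "((\<lambda>t. G (z + t *\<^sub>R b)) has_vector_derivative G' b) (at s)"
    if "(G has_derivative G') (at (z + s *\<^sub>R b))" for G :: "'a \<Rightarrow> 'b" and G' s
  proof -
    have "((\<lambda>t. z + t *\<^sub>R b) has_derivative (\<lambda>t. t *\<^sub>R b)) (at s)"
      by (auto intro!: derivative_eq_intros)
    from has_derivative_compose[OF this that]
    show ?thesis
      using linear_cmul[OF has_derivative_linear[OF that]]
      by (simp add: has_vector_derivative_def)
  qed
  define T where "T = (\<lambda>s. z + s *\<^sub>R b) -` S"
  have T: "open T" "0 \<in> T"
    unfolding T_def using S by (auto intro!: open_vimage continuous_intros)
  have "((\<lambda>s. Dg (z + s *\<^sub>R b) b) has_vector_derivative D2g b b) (at 0)"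
    by (rule line) (use D2g in simp)
  then have "((\<lambda>s. vector_derivative (\<lambda>t. g (z + t *\<^sub>R b)) (at s)) has_vector_derivative D2g b b) (at 0)"
  proof (rule has_vector_derivative_transform_within_open[OF _ T])
    show "Dg (z + s *\<^sub>R b) b = vector_derivative (\<lambda>t. g (z + t *\<^sub>R b)) (at s)" if "s \<in> T" for s
      using that by (intro vector_derivative_at[symmetric] line Dg) (auto simp: T_def)
  qed
  then show "vector_derivative (\<lambda>s. vector_derivative (\<lambda>t. g (z + t *\<^sub>R b)) (at s)) (at 0) = D2g b b"
    by (rule vector_derivative_at)
qed

lemma (in C2_unit_ball) laplacian_eq_lap: "z \<in> ball 0 1 \<Longrightarrow> laplacian u z = lap z"
  unfolding lap_def
  by (rule laplacian_eq_sum[OF open_ball _ has_derivative_u has_derivative_Du])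

text \<open>In the chain rule for the Hessian, the terms without \<open>f''\<close> are on the
  diagonal a square of \<open>f' z b\<close> and, with factor \<open>p - 2\<close>, a square of its
  component along \<open>hess_dir\<close>. Dropping them leaves the stated lower bound, which is all
  that the sign of the Laplacian requires.\<close>

lemma C2_on_norm_powr:
  fixes f :: "'a::euclidean_space \<Rightarrow> 'b::real_inner"
  assumes p: "2 \<le> p" and f: "C2_on (ball 0 1) f"
  obtains Du D2u where "C2_unit_ball (\<lambda>z. norm (f z) powr p) Du D2u"
    "\<And>z. z \<in> ball 0 1 \<Longrightarrow> p * hess_scale p (f z) * (f z \<bullet> laplacian f z) \<le> C2_unit_ball.lap D2u z"
proof -
  obtain f' f'' where
    f': "\<And>z. z \<in> ball 0 1 \<Longrightarrow> (f has_derivative blinfun_apply (f' z)) (at z)" and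
    f'': "\<And>z. z \<in> ball 0 1 \<Longrightarrow> (f' has_derivative blinfun_apply (f'' z)) (at z)" and
    cont: "continuous_on (ball 0 1) f''"
    using f unfolding C2_on_def by blast
  have f''b: "((\<lambda>x. f' x b) has_derivative (\<lambda>h. f'' z h b)) (at z)" if "z \<in> ball 0 1" for z b
    by (rule bounded_linear.has_derivative[OF bounded_linear_apply_blinfun f''[OF that]])
  have cont_f: "continuous_on (ball 0 1) f"
    by (rule has_derivative_continuous_on) (blast intro: has_derivative_at_withinI f')
  have cont_f': "continuous_on (ball 0 1) f'"
    by (rule has_derivative_continuous_on) (blast intro: has_derivative_at_withinI f'')
  define Du where "Du z h = p * (hess_scale p (f z) *\<^sub>R f z \<bullet> f' z h)" for z h
  define D2u where "D2u z h b = p * (hess_scale p (f z) *\<^sub>R f z \<bullet> f'' z h b +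
      (hess_scale p (f z) *\<^sub>R f' z h + ((p - 2) * (hess_dir p (f z) \<bullet> f' z h)) *\<^sub>R hess_dir p (f z)) \<bullet> f' z b)"
    for z h b
  have C2: "C2_unit_ball (\<lambda>z. norm (f z) powr p) Du D2u"
  proof
    fix z b :: 'a assume z: "z \<in> ball 0 1"
    show "((\<lambda>z. norm (f z) powr p) has_derivative Du z) (at z)"
      using has_derivative_compose[OF f'[OF z] has_derivative_norm_powr_ge_2[OF p]]
      by (simp only: Du_def[abs_def])
    have "((\<lambda>x. hess_scale p (f x) *\<^sub>R f x) has_derivative
        (\<lambda>h. hess_scale p (f z) *\<^sub>R f' z h + ((p - 2) * (hess_dir p (f z) \<bullet> f' z h)) *\<^sub>R hess_dir p (f z))) (at z)"
      by (rule has_derivative_compose[OF f'[OF z] has_derivative_hess_scale_scaleR[OF p]])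
    from has_derivative_mult_right[OF has_derivative_inner[OF this f''b[OF z]], of p]
    show "((\<lambda>x. Du x b) has_derivative (\<lambda>h. D2u z h b)) (at z)"
      by (simp only: Du_def[abs_def] D2u_def)
  next
    fix h b :: 'a
    have "continuous_on (ball 0 1) (\<lambda>z. hess_scale p (f z))"
      by (rule continuous_on_compose2[OF continuous_on_hess_scale[OF p] cont_f]) simp
    moreover have "continuous_on (ball 0 1) (\<lambda>z. hess_dir p (f z))"
      by (rule continuous_on_compose2[OF continuous_on_hess_dir[OF p] cont_f]) simp
    ultimately show "continuous_on (ball 0 1) (\<lambda>z. D2u z h b)"
      unfolding D2u_def by (intro continuous_intros cont cont_f cont_f')
  qed
  moreover have "p * hess_scale p (f z) * (f z \<bullet> laplacian f z) \<le> C2_unit_ball.lap D2u z"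
    if z: "z \<in> ball 0 1" for z
  proof -
    have "laplacian f z = (\<Sum>b\<in>Basis. f'' z b b)"
      by (rule laplacian_eq_sum[OF open_ball z f' f''b[OF z]])
    then have "p * hess_scale p (f z) * (f z \<bullet> laplacian f z)
        = (\<Sum>b\<in>Basis. p * (hess_scale p (f z) *\<^sub>R f z \<bullet> f'' z b b))"
      by (simp add: inner_sum_right sum_distrib_left mult.assoc)
    also have "\<dots> \<le> (\<Sum>b\<in>Basis. D2u z b b)"
    proof (rule sum_mono)
      fix b :: 'a
      have "0 \<le> p * (hess_scale p (f z) * (f' z b \<bullet> f' z b) + (p - 2) * (hess_dir p (f z) \<bullet> f' z b)\<^sup>2)"
        using p by (intro mult_nonneg_nonneg add_nonneg_nonneg hess_scale_nonneg) auto
      then show "p * (hess_scale p (f z) *\<^sub>R f z \<bullet> f'' z b b) \<le> D2u z b b"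
        by (simp add: D2u_def inner_add_left power2_eq_square distrib_left mult.assoc)
    qed
    also have "\<dots> = C2_unit_ball.lap D2u z"
      by (simp add: C2_unit_ball.lap_def[OF C2])
    finally show ?thesis .
  qed
  ultimately show ?thesis by (rule that)
qed

section \<open>The measures on the ball and the sphere\<close>

lemma unit_ball_content:
  "emeasure lborel (ball (0::'a::euclidean_space) 1) = ennreal (measure lborel (ball (0::'a) 1))"
  "0 < measure lborel (ball (0::'a) 1)"
  using emeasure_lborel_ball_finite[of "0::'a" 1]
  by (simp_all add: emeasure_eq_ennreal_measure less_top content_ball_pos)

text \<open>A real constant as density is the form in which Bochner integrals against a density are
  rewritten.\<close>

lemma dVN_eq:
  "(dVN :: (complex ^ 'n) measure) = density (restrict_space lborel (ball 0 1)) (\<lambda>_. ennreal (1 / measure lborel (ball (0::complex ^ 'n) 1)))"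
  using unit_ball_content[where 'a = "complex ^ 'n"]
  by (simp add: dVN_def divide_ennreal[of 1, symmetric] ennreal_1[symmetric] del: ennreal_1)

lemma nn_integral_dVN_finite_iff:
  fixes F :: "complex ^ 'n \<Rightarrow> ennreal"
  assumes F: "F \<in> borel_measurable (restrict_space lborel (ball 0 1))"
  shows "(\<integral>\<^sup>+z. F z \<partial>dVN) < \<infinity> \<longleftrightarrow> (\<integral>\<^sup>+z\<in>ball 0 1. F z \<partial>lborel) < \<infinity>"
proof -
  let ?c = "1 / measure lborel (ball (0::complex ^ 'n) 1)"
  have "(\<integral>\<^sup>+z. F z \<partial>dVN) = ennreal ?c * (\<integral>\<^sup>+z\<in>ball 0 1. F z \<partial>lborel)"
    unfolding dVN_eq using F
    by (simp add: nn_integral_density nn_integral_cmult nn_integral_restrict_space)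
  then show ?thesis
    using unit_ball_content(2)[where 'a = "complex ^ 'n"]
    by (auto simp: ennreal_mult_less_top)
qed

text \<open>Unfolds the push-forward. The origin is removed so that \<open>sgn\<close> takes values
  in the sphere, and as a null set it does not affect the ball integral.\<close>

lemma integral_sigmaS:
  fixes k :: "complex ^ 'n \<Rightarrow> real"
  assumes k: "k \<in> borel_measurable (restrict_space borel (sphere 0 1))"
    and int: "set_integrable lborel (ball 0 1) (\<lambda>z. k (sgn z))"
  shows "integrable sigmaS k"
    and "(\<integral>\<zeta>. k \<zeta> \<partial>sigmaS) = (LINT z:ball 0 1|lborel. k (sgn z)) / measure lborel (ball (0::complex ^ 'n) 1)"
proof -
  let ?V = "measure lborel (ball (0::complex ^ 'n) 1)"
  let ?B = "ball (0::complex ^ 'n) 1"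
  let ?R = "restrict_space dVN (?B - {0})"
  have space_dVN: "space dVN = ?B" and sets_dVN: "sets dVN = sets (restrict_space lborel ?B)"
    by (simp_all add: dVN_def space_restrict_space)
  have B0: "(?B - {0}) \<inter> space dVN \<in> sets dVN"
    by (simp add: space_dVN sets_dVN sets_restrict_space_iff Int_Diff)
  have "sgn \<in> borel_measurable ?R"
    by (intro measurable_restrict_space1) 
       (simp add: measurable_cong_sets[OF sets_dVN refl] measurable_restrict_space1)
  then have sgn: "sgn \<in> measurable ?R (restrict_space borel (sphere 0 1))"
    by (rule measurable_restrict_space2[rotated]) (auto simp: space_restrict_space norm_sgn)
  have ksgn: "(\<lambda>z. k (sgn z)) \<in> borel_measurable ?R"
    by (rule measurable_compose[OF sgn k])
  then have meas: "(\<lambda>z. indicator (?B - {0}) z *\<^sub>R k (sgn z)) \<in> borel_measurable (restrict_space lborel ?B)"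
    by (simp only: borel_measurable_restrict_space_iff[OF B0] measurable_cong_sets[OF sets_dVN refl])
  have set_int: "set_integrable lborel (?B - {0}) (\<lambda>z. k (sgn z))"
    by (rule set_integrable_subset[OF int]) auto
  have "(LINT z:?B - {0}|lborel. k (sgn z)) = (LINT z:?B|lborel. k (sgn z))"
    by (rule set_integral_discrete_difference[of "{0}"]) auto
  then have eq: "(LINT z|lborel. indicator ?B z *\<^sub>R indicator (?B - {0}) z *\<^sub>R k (sgn z)) = (LINT z:?B|lborel. k (sgn z))"
    unfolding set_lebesgue_integral_def
    by (simp add: indicator_inter_arith[symmetric] mult.assoc[symmetric] Int_absorb1)
  have int2: "integrable lborel (\<lambda>z. indicator ?B z *\<^sub>R indicator (?B - {0}) z *\<^sub>R k (sgn z))"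
    using set_int unfolding set_integrable_def
    by (simp add: indicator_inter_arith[symmetric] mult.assoc[symmetric] Int_absorb1)
  have "integrable sigmaS k \<longleftrightarrow> integrable dVN (\<lambda>z. indicator (?B - {0}) z *\<^sub>R k (sgn z))"
    unfolding sigmaS_def integrable_distr_eq[OF sgn k] integrable_restrict_space[OF B0] ..
  also have "\<dots> \<longleftrightarrow> integrable (restrict_space lborel ?B) (\<lambda>z. (1 / ?V) *\<^sub>R indicator (?B - {0}) z *\<^sub>R k (sgn z))"
    unfolding dVN_eq by (rule integrable_density) (use meas in auto)
  also have "\<dots>"
    using int2 by (intro integrable_scaleR_right) (simp add: integrable_restrict_space)
  finally show "integrable sigmaS k" .
  have "(\<integral>\<zeta>. k \<zeta> \<partial>sigmaS) = integral\<^sup>L dVN (\<lambda>z. indicator (?B - {0}) z *\<^sub>R k (sgn z))"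
    unfolding sigmaS_def integral_distr[OF sgn k] integral_restrict_space[OF B0] ..
  also have "\<dots> = integral\<^sup>L (restrict_space lborel ?B) (\<lambda>z. (1 / ?V) *\<^sub>R indicator (?B - {0}) z *\<^sub>R k (sgn z))"
    unfolding dVN_eq by (rule integral_density) (use meas in auto)
  also have "\<dots> = (1 / ?V) *\<^sub>R integral\<^sup>L (restrict_space lborel ?B) (\<lambda>z. indicator (?B - {0}) z *\<^sub>R k (sgn z))"
    by (rule integral_scaleR_right)
  also have "\<dots> = (LINT z:?B|lborel. k (sgn z)) / ?V"
    using eq by (simp add: integral_restrict_space)
  finally show "(\<integral>\<zeta>. k \<zeta> \<partial>sigmaS) = (LINT z:?B|lborel. k (sgn z)) / ?V" .
qed

text \<open>On nonnegative numbers the map is increasing, with inverse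
  \<open>B powr (1 / a) * c\<close>. It strips the p-th root and the volume normalization from the
  Hardy condition.\<close>

lemma bdd_above_divide_powr_image_iff:
  fixes m :: "'i \<Rightarrow> real"
  assumes a: "0 < a" and c: "0 < c" and m: "\<And>i. i \<in> I \<Longrightarrow> 0 \<le> m i"
  shows "bdd_above ((\<lambda>i. (m i / c) powr a) ` I) \<longleftrightarrow> bdd_above (m ` I)"
proof
  assume "bdd_above ((\<lambda>i. (m i / c) powr a) ` I)"
  then obtain B where B: "\<forall>i\<in>I. (m i / c) powr a \<le> B" by (auto simp: bdd_above_def)
  have "m i \<le> B powr (1 / a) * c" if "i \<in> I" for i
  proof -
    have "m i / c \<le> B powr (1 / a)"
      using powr_mono2[of "1 / a" "(m i / c) powr a" B] B m[OF that] a c that by (simp add: powr_powr)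
    then show ?thesis using c by (simp add: pos_divide_le_eq)
  qed
  then show "bdd_above (m ` I)" by (rule bdd_aboveI2)
next
  assume "bdd_above (m ` I)"
  then obtain B where B: "\<forall>i\<in>I. m i \<le> B" by (auto simp: bdd_above_def)
  have "(m i / c) powr a \<le> (B / c) powr a" if "i \<in> I" for i
    using B m[OF that] a c that by (intro powr_mono2 divide_right_mono) auto
  then show "bdd_above ((\<lambda>i. (m i / c) powr a) ` I)" by (rule bdd_aboveI2)
qed

section \<open>Translation to the normalized measures and the Hardy space\<close>

theorem theorem1p1:
  fixes f :: "complex ^ 'n \<Rightarrow> complex" and p :: real
  assumes "p \<ge> 2"
    and "C2_on (ball 0 1) f"
    and "\<And>z. z \<in> ball 0 1 \<Longrightarrow> Re (f z * cnj (laplacian f z)) \<ge> 0"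
  shows "(\<integral>\<^sup>+ z. ennreal (dist_bd z * laplacian (\<lambda>w. norm (f w) powr p) z) \<partial>dVN) < \<infinity>
         \<longleftrightarrow> f \<in> hardy_g p"
proof -
  define u where "u z = norm (f z) powr p" for z
  let ?V = "measure lborel (ball (0::complex ^ 'n) 1)"
  obtain Du D2u where C2: "C2_unit_ball u Du D2u" and
    lap_ge: "\<And>z. z \<in> ball 0 1 \<Longrightarrow> p * hess_scale p (f z) * (f z \<bullet> laplacian f z) \<le> C2_unit_ball.lap D2u z"
    using C2_on_norm_powr[OF assms(1,2)] unfolding u_def by blast
  interpret C2_unit_ball u Du D2u by (rule C2)
  \<comment> \<open>Since \<open>ennreal\<close> cuts negative values to 0, this sign also ensures
    that the extended integral loses no negative part.\<close>
  have lap_nonneg: "0 \<le> lap z" if "z \<in> ball 0 1" for z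
  proof -
    \<comment> \<open>The real inner product on the complex numbers is
      \<open>Re (a * cnj b)\<close>.\<close>
    have "0 \<le> f z \<bullet> laplacian f z"
      using assms(3)[OF that] by (simp add: inner_complex_def)
    then have "0 \<le> p * hess_scale p (f z) * (f z \<bullet> laplacian f z)"
      using assms(1) by (intro mult_nonneg_nonneg hess_scale_nonneg) auto
    then show ?thesis using lap_ge[OF that] by linarith
  qed
  have u_nonneg: "0 \<le> u z" for z by (simp add: u_def)
  have eq: "dist_bd z * laplacian u z = (1 - norm z) * lap z" if "z \<in> ball 0 1" for z
    using laplacian_eq_lap[OF that] by (simp add: dist_bd_def)
  \<comment> \<open>Measurability of the integrand is obtained from its agreement on the ball with
    an expression in the continuous function \<open>lap\<close>.\<close>
  have "continuous_on (ball 0 1) (\<lambda>z. (1 - norm z) * lap z)"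
    by (intro continuous_intros continuous_on_lap)
  then have "continuous_on (ball 0 1) (\<lambda>z. dist_bd z * laplacian u z)"
    by (rule continuous_on_eq) (simp add: eq)
  then have "(\<lambda>z. dist_bd z * laplacian u z) \<in> borel_measurable (restrict_space borel (ball 0 1))"
    by (rule borel_measurable_continuous_on_restrict)
  then have "(\<lambda>z. ennreal (dist_bd z * laplacian u z)) \<in> borel_measurable (restrict_space lborel (ball 0 1))"
    by (intro measurable_compose[OF _ measurable_ennreal])
       (simp add: measurable_cong_sets[OF sets_restrict_space_cong[OF sets_lborel] refl])
  then have "(\<integral>\<^sup>+ z. ennreal (dist_bd z * laplacian u z) \<partial>dVN) < \<infinity>
      \<longleftrightarrow> (\<integral>\<^sup>+z\<in>ball 0 1. ennreal (dist_bd z * laplacian u z) \<partial>lborel) < \<infinity>"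
    by (rule nn_integral_dVN_finite_iff)
  also have "(\<integral>\<^sup>+z\<in>ball 0 1. ennreal (dist_bd z * laplacian u z) \<partial>lborel)
      = (\<integral>\<^sup>+z\<in>ball 0 1. ennreal ((1 - norm z) * lap z) \<partial>lborel)"
    by (intro nn_integral_cong) (auto simp: eq indicator_def)
  also have "\<dots> < \<infinity> \<longleftrightarrow> bdd_above (mean ` {0<..<1})"
    by (rule nn_integral_laplacian_finite_iff_mean[OF lap_nonneg u_nonneg])
  also have "\<dots> \<longleftrightarrow> f \<in> hardy_g p"
  proof -
    \<comment> \<open>Gives the integrability clause of \<open>hardy_g\<close> for every radius and
      identifies the integral in \<open>Mp\<close>, so that with measurability of \<open>f\<close>
      only the boundedness clause remains.\<close>
    have slice: "integrable sigmaS (\<lambda>\<zeta>. u (r *\<^sub>R \<zeta>)) \<and> (\<integral>\<zeta>. u (r *\<^sub>R \<zeta>) \<partial>sigmaS) = mean r / ?V"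
      if r: "0 < r" "r < 1" for r
    proof -
      have "continuous_on (sphere 0 1) (\<lambda>\<zeta>. u (r *\<^sub>R \<zeta>))"
        by (rule continuous_on_compose2[OF continuous_on_u])
           (use r in \<open>auto intro!: continuous_intros\<close>)
      then have "(\<lambda>\<zeta>. u (r *\<^sub>R \<zeta>)) \<in> borel_measurable (restrict_space borel (sphere 0 1))"
        by (rule borel_measurable_continuous_on_restrict)
      moreover have "set_integrable lborel (ball 0 1) (\<lambda>z. u (r *\<^sub>R sgn z))"
        using r by (intro set_integrable_ball_sgn continuous_on_u) auto
      ultimately show ?thesis
        using integral_sigmaS[of "\<lambda>\<zeta>. u (r *\<^sub>R \<zeta>)"] unfolding mean_def by blast
    qed
    have "f differentiable_on ball 0 1"
      using assms(2) unfolding C2_on_def differentiable_on_def differentiable_def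
      by (blast intro: has_derivative_at_withinI)
    then have "f \<in> borel_measurable (restrict_space lebesgue (ball 0 1))"
      by (intro continuous_imp_measurable_on_sets_lebesgue differentiable_imp_continuous_on) auto
    then have "f \<in> hardy_g p \<longleftrightarrow> bdd_above ((\<lambda>r. (mean r / ?V) powr (1 / p)) ` {0<..<1})"
      using slice unfolding hardy_g_def Mp_def u_def by (simp cong: image_cong_simp)
    also have "\<dots> \<longleftrightarrow> bdd_above (mean ` {0<..<1})"
    proof (rule bdd_above_divide_powr_image_iff)
      show "0 \<le> mean r" for r
        unfolding mean_def set_lebesgue_integral_def using u_nonneg
        by (intro Bochner_Integration.integral_nonneg) auto
    qed (use assms(1) unit_ball_content(2) in auto)
    finally show ?thesis ..
  qed
  finally show ?thesis unfolding u_def .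
qed

end
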